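(* Let $n\geq1$ be an integer. (a) If $n$ is odd, then $$P_{2\delta_{n-1}}(X\,|\,t)=\sum_{\nu\subset\delta^*_n}P_{\delta_{n-2}+\nu}(X)\,S^{2\delta_{n-1}}_{\delta^*_n/\nu}(e(-t)).$$ (b) If $n$ is even, then $$P_{2\delta_{n-1}}(X\,|\,t)=\sum_{\nu\subset\delta_{n-1}}P_{\delta_{n-1}+\nu}(X)\,S^{2\delta_{n-1}}_{\delta_{n-1}/\nu}(e(-t)).$$ The sums are over partitions $\nu$ contained in $\delta_n^*$, respectively $\delta_{n-1}$.
   Context: $X=(x_1,x_2,\ldots)$ and $t=(t_1,t_2,\ldots)$ are sequences of independent variables; $-t=(-t_1,-t_2,\ldots)$. $\delta_r=(r,r-1,\ldots,1)$ (empty for $r\leq0$), $\delta^*_n=(n,n-1,\ldots,2)\in\mathbb Z^{n-1}$, $2\delta_{n-1}=(2n-2,2n-4,\ldots,2)$; sums of partitions are componentwise. Put $(x\,|\,t)^r=(x-t_1)\cdots(x-t_r)$. For a strict partition $\lambda$ with exactly $\ell$ nonzero parts and $n'\geq\ell$, Ivanov's double Schur $P$-function is $$P_\lambda(x_1,\ldots,x_{n'}\,|\,t)=\frac1{(n'-\ell)!}\sum_{\varpi\in S_{n'}}\varpi\left(\prod_{i=1}^\ell(x_i\,|\,t)^{\lambda_i}\prod_{i\leq\ell,\ i<j\leq n'}\frac{x_i+x_j}{x_i-x_j}\right),$$ where $S_{n'}$ permutes the $x_i$. $P_\lambda(X\,|\,t)$ is the projective limit of $P_\lambda(x_1,\ldots,x_{2m}\,|\,t)$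 as $m\to\infty$ (along even numbers of variables), and $P_\lambda(X)=P_\lambda(X\,|\,0)$ is the Schur $P$-function. For partitions $\mu,\nu$ with at most $n-1$ parts, $$S^{2\delta_{n-1}}_{\mu/\nu}(e(-t))=\det\bigl(e^{2(n-i)}_{\mu_i-\nu_j+j-i}(-t)\bigr)_{1\leq i,j\leq n-1},$$ where $e^r_p(-t)=e_p(-t_1,\ldots,-t_r)$ is the elementary symmetric polynomial ($e_0=1$, $e_p=0$ for $p<0$ or $p>r$); an empty determinant is $1$. *)

theory Defs
  imports
    "HOL-Library.Poly_Mapping"
    "HOL-Combinatorics.Permutations"
    "HOL-Computational_Algebra.Fraction_Field"
    "Jordan_Normal_Form.Determinant"
begin

text \<open>
  All sequences are indexed from 0: \<open>x 0, x 1, \<dots>\<close> stand for $x_1, x_2, \ldots$, and likewise for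
  the \<open>t\<close>-variables and for the parts of a partition.
\<close>

subsection \<open>Partitions\<close>

text \<open>A partition is an infinite non-increasing sequence with finitely many nonzero entries.
  Containment of diagrams is the pointwise order on functions.\<close>

definition is_partition :: "(nat \<Rightarrow> nat) \<Rightarrow> bool" where
  "is_partition \<nu> \<longleftrightarrow> antimono \<nu> \<and> finite {i. \<nu> i \<noteq> 0}"

definition num_parts :: "(nat \<Rightarrow> nat) \<Rightarrow> nat" where
  "num_parts \<nu> = card {i. \<nu> i \<noteq> 0}"

definition is_strict_partition :: "(nat \<Rightarrow> nat) \<Rightarrow> bool" where
  "is_strict_partition \<nu> \<longleftrightarrow> is_partition \<nu> \<and> (\<forall>i. \<nu> i \<noteq> 0 \<longrightarrow> \<nu> (Suc i) < \<nu> i)"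

definition partitions_in :: "(nat \<Rightarrow> nat) \<Rightarrow> (nat \<Rightarrow> nat) set" where
  "partitions_in \<mu> = {\<nu>. is_partition \<nu> \<and> \<nu> \<le> \<mu>}"

text \<open>Truncated subtraction makes \<open>\<delta> r\<close> vanish from index \<open>r\<close> on; in particular \<open>\<delta> (n - 2)\<close> is the
  empty partition for \<open>n \<le> 2\<close>.\<close>

definition \<delta> :: "nat \<Rightarrow> nat \<Rightarrow> nat" where
  "\<delta> r i = r - i"

definition \<delta>_star :: "nat \<Rightarrow> nat \<Rightarrow> nat" where
  "\<delta>_star n i = (if i < n - 1 then n - i else 0)"

subsection \<open>Polynomials in infinitely many variables\<close>

type_synonym 'a mpoly = "(nat \<Rightarrow>\<^sub>0 nat) \<Rightarrow>\<^sub>0 'a"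

definition Var :: "nat \<Rightarrow> 'a::comm_ring_1 mpoly" where
  "Var i = Poly_Mapping.single (Poly_Mapping.single i 1) 1"

definition Const :: "'a::comm_ring_1 \<Rightarrow> 'a mpoly" where
  "Const c = Poly_Mapping.single 0 c"

definition subst :: "(nat \<Rightarrow> 'a mpoly) \<Rightarrow> 'a::comm_ring_1 mpoly \<Rightarrow> 'a mpoly" where
  "subst \<sigma> p = (\<Sum>m\<in>Poly_Mapping.keys p. Const (Poly_Mapping.lookup p m) *
     (\<Prod>i\<in>Poly_Mapping.keys m. \<sigma> i ^ Poly_Mapping.lookup m i))"

definition restrict_vars :: "nat \<Rightarrow> 'a::comm_ring_1 mpoly \<Rightarrow> 'a mpoly" where
  "restrict_vars N = subst (\<lambda>i. if i < N then Var i else 0)"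

subsection \<open>Double Schur \<open>P\<close>-functions\<close>

text \<open>The coefficient ring \<open>'a\<close> is arbitrary here and \<open>t\<close> is a sequence in it, so that both
  $P_\lambda(X\,|\,t)$ (take \<open>'a\<close> to be $\mathbb Z[t_1,t_2,\ldots]$ and \<open>t\<close> its variables) and
  $P_\lambda(X\,|\,0)$ are instances.\<close>

definition xvar :: "nat \<Rightarrow> 'a::idom mpoly fract" where
  "xvar i = Fract (Var i) 1"

definition shifted_power :: "(nat \<Rightarrow> 'a) \<Rightarrow> 'a::idom mpoly fract \<Rightarrow> nat \<Rightarrow> 'a mpoly fract" where
  "shifted_power t x r = (\<Prod>k<r. x - Fract (Const (t k)) 1)"

text \<open>$P_\lambda(x_1,\ldots,x_N\,|\,t)$, for a strict partition \<open>lam\<close> with \<open>num_parts lam \<le> N\<close>; the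
  definition has no meaning for other arguments.\<close>

definition double_P_fin :: "(nat \<Rightarrow> nat) \<Rightarrow> (nat \<Rightarrow> 'a::idom) \<Rightarrow> nat \<Rightarrow> 'a mpoly fract" where
  "double_P_fin lam t N = (let l = num_parts lam in
     1 / of_nat (fact (N - l)) *
     (\<Sum>\<pi> | \<pi> permutes {..<N}.
        (\<Prod>i<l. shifted_power t (xvar (\<pi> i)) (lam i)) *
        (\<Prod>i<l. \<Prod>j\<in>{i<..<N}.
           (xvar (\<pi> i) + xvar (\<pi> j)) / (xvar (\<pi> i) - xvar (\<pi> j)))))"

text \<open>The projective limit along even numbers of variables: an element is a sequence whose
  \<open>m\<close>-th entry is a polynomial in the first \<open>2 * m\<close> variables (this is forced by the
  compatibility condition), with transition maps $x_{2m+1} = x_{2m+2} = 0$. Ring operations and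
  multiplication by scalars of \<open>'a\<close> are componentwise.\<close>

definition even_limit :: "(nat \<Rightarrow> 'a::comm_ring_1 mpoly) set" where
  "even_limit = {f. \<forall>m. restrict_vars (2 * m) (f (Suc m)) = f m}"

text \<open>$P_\lambda(X\,|\,t)$. The finite-variable function, a priori a rational function, is required to be
  the polynomial \<open>f m\<close>. It is only available from \<open>num_parts lam\<close> variables on, and the
  remaining finitely many components are then determined by the transition maps.\<close>

definition double_P :: "(nat \<Rightarrow> nat) \<Rightarrow> (nat \<Rightarrow> 'a::idom) \<Rightarrow> nat \<Rightarrow> 'a mpoly" where
  "double_P lam t = (THE f. f \<in> even_limit \<and>
     (\<forall>m. num_parts lam \<le> 2 * m \<longrightarrow> Fract (f m) 1 = double_P_fin lam t (2 * m)))"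

definition schur_P :: "(nat \<Rightarrow> nat) \<Rightarrow> nat \<Rightarrow> 'a::idom mpoly" where
  "schur_P lam = double_P lam (\<lambda>_. 0)"

subsection \<open>The coefficients\<close>

text \<open>$e_p(a_1,\ldots,a_r)$; the index set is empty for \<open>p < 0\<close> and for \<open>p > r\<close>.\<close>

definition elem_sym :: "nat \<Rightarrow> int \<Rightarrow> (nat \<Rightarrow> 'a::comm_ring_1) \<Rightarrow> 'a" where
  "elem_sym r p a = (\<Sum>A | A \<subseteq> {..<r} \<and> int (card A) = p. \<Prod>i\<in>A. a i)"

text \<open>$S^{2\delta_{n-1}}_{\mu/\nu}(e(-t))$.\<close>

definition S_skew :: "nat \<Rightarrow> (nat \<Rightarrow> nat) \<Rightarrow> (nat \<Rightarrow> nat) \<Rightarrow> (nat \<Rightarrow> 'a) \<Rightarrow> 'a::comm_ring_1" where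
  "S_skew n \<mu> \<nu> t = det (mat (n - 1) (n - 1) (\<lambda>(i, j).
     elem_sym (2 * (n - (i + 1))) (int (\<mu> i) - int (\<nu> j) + int j - int i) (\<lambda>k. - t k)))"

definition tvar :: "nat \<Rightarrow> int mpoly" where
  "tvar = Var"

subsection \<open>Well-formedness of the sums\<close>

lemma finite_partitions_in:
  assumes "finite {i. \<mu> i \<noteq> 0}"
  shows "finite (partitions_in \<mu>)"
proof -
  define A where "A = {i. \<mu> i \<noteq> 0}"
  define M where "M = (\<Sum>i\<in>A. \<mu> i)"
  have "partitions_in \<mu> \<subseteq> {f. \<forall>i. (i \<in> A \<longrightarrow> f i \<in> {..M}) \<and> (i \<notin> A \<longrightarrow> f i = 0)}"
  proof
    fix \<nu> assume "\<nu> \<in> partitions_in \<mu>"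
    then have le: "\<nu> i \<le> \<mu> i" for i by (auto simp: partitions_in_def le_fun_def)
    have "\<mu> i \<le> M" if "i \<in> A" for i
      unfolding M_def using that assms by (intro member_le_sum) (auto simp: A_def)
    with le show "\<nu> \<in> {f. \<forall>i. (i \<in> A \<longrightarrow> f i \<in> {..M}) \<and> (i \<notin> A \<longrightarrow> f i = 0)}"
      by (auto simp: A_def intro: order_trans) (metis le le_zero_eq)
  qed
  moreover have "finite A" using assms by (simp add: A_def)
  ultimately show ?thesis
    using finite_set_of_finite_funs[of A "{..M}" 0] by (auto intro: finite_subset)
qed

lemma finite_partitions_in_\<delta> [simp]: "finite (partitions_in (\<delta> r))"
  by (rule finite_partitions_in, rule finite_subset[of _ "{..<r}"]) (auto simp: \<delta>_def)

lemma finite_partitions_in_\<delta>_star [simp]: "finite (partitions_in (\<delta>_star n))"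
  by (rule finite_partitions_in, rule finite_subset[of _ "{..<n}"])
    (auto simp: \<delta>_star_def split: if_splits)

lemma is_strict_partition_\<delta>_add:
  assumes "is_partition \<nu>" and "\<And>i. i > r \<Longrightarrow> \<nu> i = 0"
  shows "is_strict_partition (\<lambda>i. \<delta> r i + \<nu> i)"
proof -
  have step: "\<nu> (Suc i) \<le> \<nu> i" for i
    using assms(1) by (auto simp: is_partition_def antimono_def)
  have "finite {i. \<delta> r i + \<nu> i \<noteq> 0}"
    by (rule finite_subset[of _ "{..<r} \<union> {i. \<nu> i \<noteq> 0}"])
      (use assms(1) in \<open>auto simp: \<delta>_def is_partition_def\<close>)
  moreover have "antimono (\<lambda>i. \<delta> r i + \<nu> i)"
    unfolding antimono_iff_le_Suc \<delta>_def using step by (auto intro!: add_mono)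
  moreover have "\<delta> r (Suc i) + \<nu> (Suc i) < \<delta> r i + \<nu> i" if "\<delta> r i + \<nu> i \<noteq> 0" for i
  proof (cases "i < r")
    case True then show ?thesis using step[of i] by (simp add: \<delta>_def)
  next
    case False
    then show ?thesis using that assms(2)[of "Suc i"] by (simp add: \<delta>_def)
  qed
  ultimately show ?thesis by (simp add: is_strict_partition_def is_partition_def)
qed

end

theory Submission
  imports Defs "HOL-Computational_Algebra.Polynomial_Factorial" "HOL-Combinatorics.Multiset_Permutations"
begin

text \<open>
  Expanding each factor $(x\,|\,t)^{2(n-i)}$ in powers of $x$ turns the left-hand side into a
  combination of sums with plain powers: the coefficient of $x^a$ is
  $e^{2(n-i)}_{2(n-i)-a}(-t)$, and the defining sum over permutations is linear in the function
  put into each of the $n-1$ distinguished slots. The sums that remain make sense for every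
  exponent sequence $a \in \mathbb N^{n-1}$, and the antisymmetry of $(x_i+x_j)/(x_i-x_j)$ makes them
  alternating in $a$. Hence only sequences of distinct exponents contribute, each is a
  rearrangement of a unique strictly decreasing $\kappa$, and collecting the rearrangements of
  $\kappa$ produces the determinant of the $e^{2(n-i)}_{2(n-i)-\kappa_j}(-t)$. With
  $\kappa = \delta + \nu$ the indices become $\mu_i - \nu_j + j - i$; the determinant vanishes
  unless $\nu \subset \mu$.

  The parity of $n$ enters through an exponent $0$ in the last slot. In an even number $N$ of
  variables, $N-(n-2)$ of them are left for that slot, and the sum over them is
  $\sum_i \prod_{j \ne i} (x_i+x_j)/(x_i-x_j)$, which is $1$ for an odd and $0$ for an even number of
  variables (\<open>sum_prod_ratio\<close>). For odd $n$ the exponent $0$ may therefore be dropped, and $\kappa$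
  runs over $\delta_{n-2}+\nu$; for even $n$ the whole term vanishes, so that all exponents are
  positive and $\kappa$ runs over $\delta_{n-1}+\nu$.

  As both sides are defined as projective limits, it must also be shown that the functions
  $P_\kappa(X)$ exist, i.e. that the finite sums are polynomials (\<open>P_pow_polynomial\<close>) that are
  compatible with setting a variable to $0$ (\<open>P_pow_stable\<close>). Existence of the left-hand side then
  comes for free: the right-hand side lies in the limit and has the required components
  (\<open>double_P_eqI\<close>). Polynomiality holds because denominators are products of differences
  $x_k-x_l$, and the two terms of the sum that are singular along $x_k = x_l$ cancel there.
\<close>

section \<open>Substitution as a ring homomorphism\<close>

definition eval_monom :: "(nat \<Rightarrow> 'a mpoly) \<Rightarrow> (nat \<Rightarrow>\<^sub>0 nat) \<Rightarrow> 'a::comm_ring_1 mpoly" where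
  "eval_monom \<sigma> m = (\<Prod>i\<in>Poly_Mapping.keys m. \<sigma> i ^ Poly_Mapping.lookup m i)"

lemma eval_monom_superset:
  assumes "finite K" "Poly_Mapping.keys m \<subseteq> K"
  shows "eval_monom \<sigma> m = (\<Prod>i\<in>K. \<sigma> i ^ Poly_Mapping.lookup m i)"
  unfolding eval_monom_def
  by (intro prod.mono_neutral_left assms ballI) (simp add: in_keys_iff)

lemma eval_monom_add: "eval_monom \<sigma> (m + m') = eval_monom \<sigma> m * eval_monom \<sigma> m'"
proof -
  define K where "K = Poly_Mapping.keys m \<union> Poly_Mapping.keys m'"
  have K: "finite K" "Poly_Mapping.keys m \<subseteq> K" "Poly_Mapping.keys m' \<subseteq> K"
    "Poly_Mapping.keys (m + m') \<subseteq> K"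
    using Poly_Mapping.keys_add[of m m'] by (auto simp: K_def)
  show ?thesis
    by (simp add: eval_monom_superset[OF K(1,2)] eval_monom_superset[OF K(1,3)]
        eval_monom_superset[OF K(1,4)] lookup_add power_add prod.distrib)
qed

lemma Const_add: "Const (c + d) = Const c + Const d"
  by (simp add: Const_def single_add)

lemma Const_mult: "Const (c * d) = Const c * Const d"
  by (simp add: Const_def mult_single)

lemma Const_0 [simp]: "Const 0 = 0" and Const_1 [simp]: "Const 1 = 1"
  by (simp_all add: Const_def)

lemma Const_uminus: "Const (- c) = - Const c"
  by (simp add: Const_def single_uminus)

lemma subst_superset:
  assumes "finite K" "Poly_Mapping.keys p \<subseteq> K"
  shows "subst \<sigma> p = (\<Sum>m\<in>K. Const (Poly_Mapping.lookup p m) * eval_monom \<sigma> m)"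
  unfolding subst_def eval_monom_def[symmetric]
  by (intro sum.mono_neutral_left assms ballI) (simp add: in_keys_iff)

lemma subst_add: "subst \<sigma> (p + q) = subst \<sigma> p + subst \<sigma> q"
proof -
  define K where "K = Poly_Mapping.keys p \<union> Poly_Mapping.keys q"
  have K: "finite K" "Poly_Mapping.keys p \<subseteq> K" "Poly_Mapping.keys q \<subseteq> K"
    "Poly_Mapping.keys (p + q) \<subseteq> K"
    using Poly_Mapping.keys_add[of p q] by (auto simp: K_def)
  show ?thesis
    by (simp add: subst_superset[OF K(1,2)] subst_superset[OF K(1,3)]
        subst_superset[OF K(1,4)] lookup_add Const_add algebra_simps sum.distrib)
qed

lemma subst_single: "subst \<sigma> (Poly_Mapping.single m c) = Const c * eval_monom \<sigma> m"
  by (subst subst_superset[of "{m}"]) auto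

lemma subst_0 [simp]: "subst \<sigma> 0 = 0"
  by (simp add: subst_def)

lemma subst_1 [simp]: "subst \<sigma> 1 = 1"
  using subst_single[of \<sigma> 0 1] by (simp add: eval_monom_def)

lemma mpoly_as_sum: "p = (\<Sum>m\<in>Poly_Mapping.keys p. Poly_Mapping.single m (Poly_Mapping.lookup p m))"
  by (rule poly_mapping_eqI) (auto simp: lookup_sum lookup_single when_def in_keys_iff)

lemma subst_sum: "subst \<sigma> (sum f A) = (\<Sum>a\<in>A. subst \<sigma> (f a))"
  by (induction A rule: infinite_finite_induct) (simp_all add: subst_add)

lemma subst_mult: "subst \<sigma> (p * q) = subst \<sigma> p * subst \<sigma> q"
proof -
  let ?K = "Poly_Mapping.keys" and ?l = "Poly_Mapping.lookup"
  have "p * q = (\<Sum>m\<in>?K p. \<Sum>m'\<in>?K q. Poly_Mapping.single (m + m') (?l p m * ?l q m'))"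
    by (subst mpoly_as_sum[of p], subst mpoly_as_sum[of q]) (simp add: sum_product mult_single)
  then show ?thesis
    by (simp add: subst_sum subst_single sum_product eval_monom_add Const_mult mult_ac
      subst_def[of \<sigma> p, folded eval_monom_def] subst_def[of \<sigma> q, folded eval_monom_def])
qed

lemma subst_Const [simp]: "subst \<sigma> (Const c) = Const c"
  unfolding Const_def by (simp add: subst_single eval_monom_def Const_def)

lemma subst_Var [simp]: "subst \<sigma> (Var i) = \<sigma> i"
  unfolding Var_def by (simp add: subst_single eval_monom_def)

lemma subst_uminus: "subst \<sigma> (- p) = - subst \<sigma> p"
  using subst_add[of \<sigma> p "- p"] by (simp add: eq_neg_iff_add_eq_0 add.commute)

lemma Var_power: "Var i ^ k = Poly_Mapping.single (Poly_Mapping.single i k) (1::'a::comm_ring_1)"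
  by (induction k) (simp_all add: Var_def mult_single flip: single_add)

lemma monom_as_prod:
  "Poly_Mapping.single m c = Const c * (\<Prod>i\<in>Poly_Mapping.keys m. Var i ^ Poly_Mapping.lookup m i)"
proof -
  have "Poly_Mapping.single (\<Sum>i\<in>I. Poly_Mapping.single i (f i)) (1::'a) = (\<Prod>i\<in>I. Var i ^ f i)"
    if "finite I" for I and f :: "nat \<Rightarrow> nat"
    using that
  proof (induction I)
    case (insert i I)
    have "Poly_Mapping.single (\<Sum>i\<in>insert i I. Poly_Mapping.single i (f i)) (1::'a)
        = Var i ^ f i * Poly_Mapping.single (\<Sum>i\<in>I. Poly_Mapping.single i (f i)) 1"
      using insert.hyps by (simp add: Var_power mult_single)
    then show ?case using insert by simp
  qed simp
  from this[of "Poly_Mapping.keys m" "Poly_Mapping.lookup m"]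
  show ?thesis
    using mult_single[of 0 c m 1] by (simp add: Const_def flip: mpoly_as_sum)
qed

text \<open>
  Constants and variables generate the polynomial ring; identities between compositions of
  substitutions need to be checked only on them.
\<close>

lemma mpoly_induct [case_names Const Var add mult]:
  fixes p :: "'a::comm_ring_1 mpoly"
  assumes "\<And>c. P (Const c)" "\<And>i. P (Var i)"
    and add: "\<And>p q. P p \<Longrightarrow> P q \<Longrightarrow> P (p + q)" and mult: "\<And>p q. P p \<Longrightarrow> P q \<Longrightarrow> P (p * q)"
  shows "P p"
proof -
  have 0: "P 0" and 1: "P 1" using assms(1)[of 0] assms(1)[of 1] by simp_all
  have pow: "P (q ^ k)" if "P q" for q k
    using that by (induction k) (auto intro: 1 mult)
  have prod: "P (prod f A)" if "\<And>a. P (f a)" for f and A :: "nat set"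
    by (induction A rule: infinite_finite_induct) (auto intro: 1 mult that)
  have "P (Poly_Mapping.single m c)" for m c
    unfolding monom_as_prod by (intro mult prod pow assms)
  then have "P (\<Sum>m\<in>A. Poly_Mapping.single m (Poly_Mapping.lookup p m))" for A
    by (induction A rule: infinite_finite_induct) (auto intro: 0 add)
  then show ?thesis using mpoly_as_sum by metis
qed

lemma subst_subst: "subst \<sigma> (subst \<tau> p) = subst (\<lambda>i. subst \<sigma> (\<tau> i)) p"
  by (induction p rule: mpoly_induct) (simp_all add: subst_add subst_mult)

text \<open>
  Modulo $x_k - x_l$ every polynomial equals its restriction to the diagonal $x_k = x_l$. In
  particular a polynomial vanishing there is divisible by $x_k - x_l$.
\<close>

lemma factor_theorem: "Var k - Var l dvd p - subst (Var(k := Var l)) p"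
proof (induction p rule: mpoly_induct)
  case (mult p q)
  have "p * q - subst (Var(k := Var l)) (p * q)
      = p * (q - subst (Var(k := Var l)) q) + (p - subst (Var(k := Var l)) p) * subst (Var(k := Var l)) q"
    by (simp add: subst_mult algebra_simps)
  then show ?case using mult by (metis dvd_add dvd_mult dvd_mult2)
next
  case (add p q)
  have "p + q - subst (Var(k := Var l)) (p + q)
      = (p - subst (Var(k := Var l)) p) + (q - subst (Var(k := Var l)) q)"
    by (simp add: subst_add)
  with add show ?case by (metis dvd_add)
qed auto

lemma Var_eq_iff [simp]: "(Var i :: 'a::comm_ring_1 mpoly) = Var j \<longleftrightarrow> i = j"
proof
  assume "(Var i :: 'a mpoly) = Var j"
  then have "Poly_Mapping.lookup (Var i :: 'a mpoly) (Poly_Mapping.single j 1) = 1"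
    by (simp add: Var_def)
  then have "Poly_Mapping.single i (1::nat) = Poly_Mapping.single j 1"
    unfolding Var_def by (rule_tac ccontr) (simp add: lookup_single_not_eq)
  then have "Poly_Mapping.lookup (Poly_Mapping.single i (1::nat)) j = 1" by simp
  then show "i = j" by (rule_tac ccontr) (simp add: lookup_single_not_eq)
qed auto

lemma Var_neq_0 [simp]: "(Var i :: 'a::comm_ring_1 mpoly) \<noteq> 0"
proof
  assume "(Var i :: 'a mpoly) = 0"
  then have "Poly_Mapping.lookup (Var i :: 'a mpoly) (Poly_Mapping.single i 1) = 0" by simp
  then show False by (simp add: Var_def)
qed

lemma restrict_vars_restrict_vars:
  "M \<le> N \<Longrightarrow> restrict_vars M (restrict_vars N p) = restrict_vars M p"
  unfolding restrict_vars_def subst_subst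
  by (rule arg_cong[of _ _ "\<lambda>s. subst s p"]) (auto simp: fun_eq_iff)

section \<open>Specialization of rational functions\<close>

text \<open>
  A substitution extends to those rational functions whose denominator it does not annihilate. The
  relation \<open>spec\<close> is this partial ring homomorphism, given by its graph: a fraction can have
  representations to which the substitution applies and others to which it does not.
\<close>

definition spec :: "(nat \<Rightarrow> 'a mpoly) \<Rightarrow> 'a::idom mpoly fract \<Rightarrow> 'a mpoly fract \<Rightarrow> bool" where
  "spec \<sigma> F G \<longleftrightarrow> (\<exists>P Q. subst \<sigma> Q \<noteq> 0 \<and> F = Fract P Q \<and> G = Fract (subst \<sigma> P) (subst \<sigma> Q))"

text \<open>
  Cross-multiplied equality of fractions is an equation between polynomials, so it survives the
  substitution.
\<close>

lemma spec_unique: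
  assumes "spec \<sigma> F G" "spec \<sigma> F G'" shows "G = G'"
proof -
  from assms obtain P Q P' Q' where *: "subst \<sigma> Q \<noteq> 0" "F = Fract P Q" "G = Fract (subst \<sigma> P) (subst \<sigma> Q)"
    "subst \<sigma> Q' \<noteq> 0" "F = Fract P' Q'" "G' = Fract (subst \<sigma> P') (subst \<sigma> Q')"
    unfolding spec_def by blast
  then have "Q \<noteq> 0" "Q' \<noteq> 0" by auto
  with * have "P * Q' = P' * Q" by (simp add: eq_fract)
  then have "subst \<sigma> P * subst \<sigma> Q' = subst \<sigma> P' * subst \<sigma> Q" by (simp flip: subst_mult)
  with * show ?thesis by (simp add: eq_fract)
qed

lemma spec_to_fract: "spec \<sigma> (to_fract p) (to_fract (subst \<sigma> p))"
  unfolding spec_def to_fract_def by (rule exI[of _ p], rule exI[of _ 1]) simp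

lemma spec_add:
  assumes "spec \<sigma> F G" "spec \<sigma> F' G'" shows "spec \<sigma> (F + F') (G + G')"
proof -
  from assms obtain P Q P' Q' where *: "subst \<sigma> Q \<noteq> 0" "F = Fract P Q" "G = Fract (subst \<sigma> P) (subst \<sigma> Q)"
    "subst \<sigma> Q' \<noteq> 0" "F' = Fract P' Q'" "G' = Fract (subst \<sigma> P') (subst \<sigma> Q')"
    unfolding spec_def by blast
  then have "Q \<noteq> 0" "Q' \<noteq> 0" by auto
  with * show ?thesis unfolding spec_def
    by (intro exI[of _ "P * Q' + P' * Q"] exI[of _ "Q * Q'"]) (simp add: subst_add subst_mult)
qed

lemma spec_mult:
  assumes "spec \<sigma> F G" "spec \<sigma> F' G'" shows "spec \<sigma> (F * F') (G * G')"
proof -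
  from assms obtain P Q P' Q' where *: "subst \<sigma> Q \<noteq> 0" "F = Fract P Q" "G = Fract (subst \<sigma> P) (subst \<sigma> Q)"
    "subst \<sigma> Q' \<noteq> 0" "F' = Fract P' Q'" "G' = Fract (subst \<sigma> P') (subst \<sigma> Q')"
    unfolding spec_def by blast
  then show ?thesis unfolding spec_def
    by (intro exI[of _ "P * P'"] exI[of _ "Q * Q'"]) (simp add: subst_mult)
qed

lemma spec_inverse:
  assumes "spec \<sigma> F G" "G \<noteq> 0" shows "spec \<sigma> (inverse F) (inverse G)"
proof -
  from assms obtain P Q where *: "subst \<sigma> Q \<noteq> 0" "F = Fract P Q" "G = Fract (subst \<sigma> P) (subst \<sigma> Q)"
    unfolding spec_def by blast
  with assms(2) have "subst \<sigma> P \<noteq> 0" by (auto simp: fract_collapse)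
  with * show ?thesis unfolding spec_def
    by (intro exI[of _ "Q"] exI[of _ "P"]) simp
qed

lemma spec_divide:
  "spec \<sigma> F G \<Longrightarrow> spec \<sigma> F' G' \<Longrightarrow> G' \<noteq> 0 \<Longrightarrow> spec \<sigma> (F / F') (G / G')"
  by (simp add: divide_inverse spec_mult spec_inverse)

lemma spec_0: "spec \<sigma> 0 0" and spec_1: "spec \<sigma> 1 1"
  using spec_to_fract[of \<sigma> 0] spec_to_fract[of \<sigma> 1] by simp_all

lemma spec_uminus: "spec \<sigma> F G \<Longrightarrow> spec \<sigma> (- F) (- G)"
  using spec_mult[OF spec_to_fract[of \<sigma> "-1"]] by (fastforce simp: subst_uminus)

lemma spec_diff: "spec \<sigma> F G \<Longrightarrow> spec \<sigma> F' G' \<Longrightarrow> spec \<sigma> (F - F') (G - G')"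
  using spec_add[OF _ spec_uminus, of \<sigma> F G F' G'] by simp

lemma spec_sum: "(\<And>i. i \<in> I \<Longrightarrow> spec \<sigma> (F i) (G i)) \<Longrightarrow> spec \<sigma> (sum F I) (sum G I)"
  by (induction I rule: infinite_finite_induct) (simp_all add: spec_0 spec_add)

lemma spec_prod: "(\<And>i. i \<in> I \<Longrightarrow> spec \<sigma> (F i) (G i)) \<Longrightarrow> spec \<sigma> (prod F I) (prod G I)"
  by (induction I rule: infinite_finite_induct) (simp_all add: spec_1 spec_mult)

lemma spec_power: "spec \<sigma> F G \<Longrightarrow> spec \<sigma> (F ^ k) (G ^ k)"
  by (induction k) (simp_all add: spec_1 spec_mult)

lemma xvar_to_fract: "xvar i = to_fract (Var i)"
  by (simp add: xvar_def to_fract_def)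

lemma xvar_eq_iff [simp]: "xvar i = xvar j \<longleftrightarrow> i = j"
  by (simp add: xvar_to_fract)

lemma xvar_neq_0 [simp]: "xvar i \<noteq> 0"
  by (simp add: xvar_to_fract)

lemma spec_xvar: "spec \<sigma> (xvar i) (to_fract (\<sigma> i))"
  using spec_to_fract[of \<sigma> "Var i"] by (simp add: xvar_to_fract)

text \<open>
  A function vanishing on the diagonal has a numerator divisible by $x_k - x_l$.
\<close>

lemma spec_zero_imp_regular_quotient:
  fixes F :: "'a::idom mpoly fract"
  assumes "k \<noteq> l" "spec (Var(k := Var l)) F 0"
  shows "\<exists>G. spec (Var(k := Var l)) (F / (xvar k - xvar l)) G"
proof -
  let ?\<sigma> = "Var(k := Var l) :: nat \<Rightarrow> 'a mpoly"
  obtain P Q where *: "subst ?\<sigma> Q \<noteq> 0" "F = Fract P Q" "0 = Fract (subst ?\<sigma> P) (subst ?\<sigma> Q)"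
    using assms(2) unfolding spec_def by blast
  then have "subst ?\<sigma> P = 0" by (simp add: Zero_fract_def eq_fract)
  with factor_theorem[of k l P] obtain R where R: "P = (Var k - Var l) * R" by auto
  have "xvar k - xvar l = Fract (Var k - Var l :: 'a mpoly) 1"
    by (simp add: xvar_def)
  then have "F / (xvar k - xvar l) = Fract P (Q * (Var k - Var l))"
    by (simp add: *)
  also have "\<dots> = Fract R Q"
    using assms(1) *(1) by (subst eq_fract) (auto simp: R)
  finally show ?thesis using *(1) unfolding spec_def by blast
qed

text \<open>
  If $G\,(x_k-x_l)$ is a polynomial $p$ and $G$ has no pole along $x_k = x_l$, then $p$ vanishes
  there, so the factor divides $p$.
\<close>

lemma polynomial_cancel_difference:
  fixes G :: "'a::idom mpoly fract"
  assumes "k \<noteq> l" and reg: "spec (Var(k := Var l)) G H"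
    and poly: "G * (xvar k - xvar l) \<in> range to_fract"
  shows "G \<in> range to_fract"
proof -
  let ?\<sigma> = "Var(k := Var l) :: nat \<Rightarrow> 'a mpoly"
  obtain p where p: "G * (xvar k - xvar l) = to_fract p" using poly by auto
  have "spec ?\<sigma> (G * (xvar k - xvar l)) (H * (to_fract (?\<sigma> k) - to_fract (?\<sigma> l)))"
    by (intro spec_mult spec_diff reg spec_xvar)
  then have "to_fract (subst ?\<sigma> p) = 0"
    using spec_unique[OF spec_to_fract[of ?\<sigma> p]] p assms(1) by simp
  then obtain q where "p = (Var k - Var l) * q"
    using factor_theorem[of k l p] by auto
  then have "G * (xvar k - xvar l) = to_fract q * (xvar k - xvar l)"
    using p by (simp add: xvar_to_fract)
  then show ?thesis using assms(1) by simp
qed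

section \<open>The symmetrized sums\<close>

definition ratio :: "(nat \<Rightarrow> 'f::field) \<Rightarrow> nat \<Rightarrow> nat \<Rightarrow> 'f" where
  "ratio x i j = (x i + x j) / (x i - x j)"

text \<open>
  Ivanov's symmetrization with an arbitrary function of the variable in each distinguished slot: the
  first slot is filled by a variable $x_i$, and the remaining slots are filled from the
  variables other than $x_i$. Summing over the choices for the distinguished slots only amounts to
  dividing the sum over all permutations by $(n'-\ell)!$, so no division by an integer
  occurs here.
\<close>

fun P_sum :: "(nat \<Rightarrow> 'f::field) \<Rightarrow> (nat \<Rightarrow> 'f) list \<Rightarrow> nat set \<Rightarrow> 'f" where
  "P_sum x [] S = 1"
| "P_sum x (f # fs) S = (\<Sum>i\<in>S. f i * (\<Prod>j\<in>S - {i}. ratio x i j) * P_sum x fs (S - {i}))"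

abbreviation P_pow :: "nat list \<Rightarrow> nat set \<Rightarrow> 'a::idom mpoly fract" where
  "P_pow as S \<equiv> P_sum xvar (map (\<lambda>a i. xvar i ^ a) as) S"

lemma spec_ratio:
  assumes "\<sigma> i = Var i'" "\<sigma> j = Var j'" "i' \<noteq> j'"
  shows "spec \<sigma> (ratio xvar i j) (ratio xvar i' j')"
  unfolding ratio_def using assms spec_xvar[of \<sigma> i] spec_xvar[of \<sigma> j]
  by (intro spec_divide spec_add spec_diff) (simp_all add: xvar_to_fract[symmetric])

text \<open>
  Injectivity on \<open>S\<close> keeps the denominators nonzero, and the sum has the same shape over any
  set of variables.
\<close>

lemma spec_relabel:
  assumes "inj_on \<tau> S" "\<And>i. i \<in> S \<Longrightarrow> \<sigma> i = Var (\<tau> i)"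
  shows "spec \<sigma> (P_pow as S) (P_pow as (\<tau> ` S))"
  using assms
proof (induction as arbitrary: S)
  case Nil
  then show ?case by (simp add: spec_1)
next
  case (Cons a as)
  have diff: "\<tau> ` S - {\<tau> i} = \<tau> ` (S - {i})" if "i \<in> S" for i
    using Cons.prems(1) that by (auto simp: inj_on_def)
  have inj: "inj_on \<tau> (S - {i})" for i
    using Cons.prems(1) by (rule inj_on_subset) auto
  have P: "P_pow (a # as) (\<tau> ` S) = (\<Sum>i\<in>S. xvar (\<tau> i) ^ a *
      (\<Prod>j\<in>S - {i}. ratio xvar (\<tau> i) (\<tau> j)) * P_pow as (\<tau> ` (S - {i})))"
    by (simp add: sum.reindex[OF Cons.prems(1)] diff prod.reindex[OF inj])
  show ?case
    unfolding P
    unfolding list.map P_sum.simps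
  proof (intro spec_sum spec_mult)
    fix i assume i: "i \<in> S"
    show "spec \<sigma> (xvar i ^ a) (xvar (\<tau> i) ^ a)"
      using spec_xvar[of \<sigma> i] Cons.prems(2)[OF i] by (intro spec_power) (simp add: xvar_to_fract)
    show "spec \<sigma> (\<Prod>j\<in>S - {i}. ratio xvar i j) (\<Prod>j\<in>S - {i}. ratio xvar (\<tau> i) (\<tau> j))"
      using Cons.prems i by (intro spec_prod spec_ratio) (auto simp: inj_on_def)
    show "spec \<sigma> (P_pow as (S - {i})) (P_pow as (\<tau> ` (S - {i})))"
      using Cons.prems inj by (intro Cons.IH) auto
  qed
qed

text \<open>
  Terms with $x_v$ in a distinguished slot vanish because its exponent is positive; in all others
  the factor $(x_i+x_v)/(x_i-x_v)$ becomes $1$.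
\<close>

lemma spec_set_variable_to_zero:
  assumes "finite S" "v \<notin> S" "\<sigma> v = 0" "\<And>i. i \<in> S \<Longrightarrow> \<sigma> i = Var i" "0 \<notin> set as"
  shows "spec \<sigma> (P_pow as (insert v S)) (P_pow as S)"
  using assms
proof (induction as arbitrary: S)
  case Nil
  then show ?case by (simp add: spec_1)
next
  case (Cons a as)
  have xv: "spec \<sigma> (xvar v) 0"
    using spec_xvar[of \<sigma> v] Cons.prems by simp
  have xi: "spec \<sigma> (xvar i) (xvar i)" if "i \<in> S" for i
    using spec_xvar[of \<sigma> i] Cons.prems that by (simp add: xvar_to_fract)
  have id: "spec \<sigma> (P_pow as S) (P_pow as S)"
    using spec_relabel[of id S \<sigma> as] Cons.prems by simp
  have "spec \<sigma> (ratio xvar v j) ((0 + xvar j) / (0 - xvar j))" if "j \<in> S" for j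
    unfolding ratio_def using that by (intro spec_divide spec_add spec_diff xv xi) auto
  then have "spec \<sigma> (xvar v ^ a * (\<Prod>j\<in>S. ratio xvar v j) * P_pow as S)
      (0 ^ a * (\<Prod>j\<in>S. (0 + xvar j) / (0 - xvar j)) * P_pow as S)"
    by (intro spec_mult spec_power xv spec_prod id)
  moreover have "(0 :: 'a mpoly fract) ^ a = 0"
    using Cons.prems(5) by (cases a) auto
  ultimately have v: "spec \<sigma> (xvar v ^ a * (\<Prod>j\<in>S. ratio xvar v j) * P_pow as S) 0"
    by simp
  have i: "spec \<sigma> (xvar i ^ a * (\<Prod>j\<in>insert v S - {i}. ratio xvar i j) * P_pow as (insert v S - {i}))
      (xvar i ^ a * (\<Prod>j\<in>S - {i}. ratio xvar i j) * P_pow as (S - {i}))" if i: "i \<in> S" for i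
  proof -
    have ins: "insert v S - {i} = insert v (S - {i})" "v \<notin> S - {i}" "finite (S - {i})"
      using i Cons.prems by auto
    have "spec \<sigma> (ratio xvar i v) ((xvar i + 0) / (xvar i - 0))"
      unfolding ratio_def using i by (intro spec_divide spec_add spec_diff xv xi) auto
    then have r: "spec \<sigma> (ratio xvar i v) 1" by simp
    have "spec \<sigma> (xvar i ^ a * (ratio xvar i v * (\<Prod>j\<in>S - {i}. ratio xvar i j)) * P_pow as (insert v (S - {i})))
      (xvar i ^ a * (1 * (\<Prod>j\<in>S - {i}. ratio xvar i j)) * P_pow as (S - {i}))"
      using i Cons.prems by (intro spec_mult spec_power xi r spec_prod spec_ratio Cons.IH) auto
    then show ?thesis using ins by simp
  qed
  have "insert v S - {v} = S" using Cons.prems by auto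
  with spec_add[OF v spec_sum[OF i, of S]] Cons.prems show ?case by simp
qed

section \<open>Polynomiality and stability\<close>

text \<open>
  There is no pole along $x_k = x_l$. By induction, only the terms with $x_k$ or $x_l$ in the first
  slot have a factor $1/(x_k-x_l)$. They arise from each other by exchanging $x_k$ and $x_l$, and
  $(x_k+x_l)/(x_k-x_l)$ changes sign under the exchange. So their sum is
  $(x_k+x_l)(A_k - A_l)/(x_k-x_l)$, where $A_k$ and $A_l$ are the two terms without that factor, and
  these agree on the diagonal.
\<close>

lemma regular_on_diagonal:
  fixes S :: "nat set"
  assumes "k \<noteq> l" "finite S"
  shows "\<exists>G. spec (Var(k := Var l)) (P_pow as S :: 'a::idom mpoly fract) G"
  using assms(2)
proof (induction as arbitrary: S)
  case Nil
  then show ?case using spec_1 by auto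
next
  case (Cons a as)
  define \<tau> where "\<tau> = id(k := l)"
  define \<sigma> :: "nat \<Rightarrow> 'a mpoly" where "\<sigma> = Var(k := Var l)"
  have \<sigma>: "\<sigma> i = Var (\<tau> i)" for i by (simp add: \<sigma>_def \<tau>_def)
  show ?case unfolding \<sigma>_def[symmetric]
  proof (cases "k \<in> S \<and> l \<in> S")
    case False
    then have "inj_on \<tau> S" by (auto simp: inj_on_def \<tau>_def)
    from spec_relabel[OF this \<sigma>] show "\<exists>G. spec \<sigma> (P_pow (a # as) S) G" by blast
  next
    case True
    then have kl: "k \<in> S" "l \<in> S" by auto
    define R where "R = S - {k, l}"
    have xi: "spec \<sigma> (xvar i) (xvar (\<tau> i))" for i
      using spec_xvar[of \<sigma> i] by (simp add: \<sigma> xvar_to_fract)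
    define T :: "nat \<Rightarrow> 'a mpoly fract" where
      "T i = xvar i ^ a * (\<Prod>j\<in>S - {i}. ratio xvar i j) * P_pow as (S - {i})" for i
    have "\<exists>G. spec \<sigma> (T i) G" if "i \<in> R" for i
    proof -
      obtain H where "spec \<sigma> (P_pow as (S - {i})) H"
        using Cons.IH[of "S - {i}"] Cons.prems unfolding \<sigma>_def by blast
      moreover have "\<tau> i \<noteq> \<tau> j" if "j \<noteq> i" for j
        using that \<open>i \<in> R\<close> by (auto simp: \<tau>_def R_def)
      ultimately have "spec \<sigma> (T i) (xvar (\<tau> i) ^ a * (\<Prod>j\<in>S - {i}. ratio xvar (\<tau> i) (\<tau> j)) * H)"
        unfolding T_def by (intro spec_mult spec_power spec_prod spec_ratio xi \<sigma>) auto
      then show ?thesis by blast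
    qed
    then obtain U where U: "spec \<sigma> (T i) (U i)" if "i \<in> R" for i by metis
    define A :: "nat \<Rightarrow> 'a mpoly fract" where
      "A i = xvar i ^ a * (\<Prod>j\<in>R. ratio xvar i j) * P_pow as (S - {i})" for i
    have "\<tau> ` (S - {k}) = S - {k}" "\<tau> ` (S - {l}) = S - {k}" "inj_on \<tau> (S - {k})" "inj_on \<tau> (S - {l})"
      using kl assms(1) by (auto simp: \<tau>_def inj_on_def image_def)
    then have PA: "spec \<sigma> (P_pow as (S - {i})) (P_pow as (S - {k}))" if "i \<in> {k, l}" for i
      using spec_relabel[of \<tau> "S - {i}" \<sigma> as] that \<sigma> by auto
    have A: "spec \<sigma> (A i) (xvar l ^ a * (\<Prod>j\<in>R. ratio xvar l (\<tau> j)) * P_pow as (S - {k}))"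
      if "i \<in> {k, l}" for i
    proof -
      have i: "\<tau> i = l" using that by (auto simp: \<tau>_def)
      then have "spec \<sigma> (xvar i) (xvar l)" using xi[of i] by simp
      then show ?thesis unfolding A_def using that i
        by (intro spec_mult spec_power spec_prod spec_ratio PA) (auto simp: \<sigma> R_def \<tau>_def)
    qed
    have "spec \<sigma> (A k - A l) 0"
      using spec_diff[OF A[of k] A[of l]] by simp
    then obtain V where "spec \<sigma> ((A k - A l) / (xvar k - xvar l)) V"
      using spec_zero_imp_regular_quotient[OF assms(1)] unfolding \<sigma>_def by blast
    from spec_mult[OF spec_add[OF xi xi] this]
    have "spec \<sigma> ((xvar k + xvar l) * ((A k - A l) / (xvar k - xvar l)))
       ((xvar (\<tau> k) + xvar (\<tau> l)) * V)" .
    moreover have "T k + T l = (xvar k + xvar l) * ((A k - A l) / (xvar k - xvar l))"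
    proof -
      have "S - {k} = insert l R" "S - {l} = insert k R" "k \<notin> R" "l \<notin> R" "finite R"
        using kl assms(1) Cons.prems by (auto simp: R_def)
      then have "T k = ratio xvar k l * A k" "T l = ratio xvar l k * A l"
        unfolding T_def A_def by simp_all
      moreover have "ratio xvar l k = - ratio (xvar :: nat \<Rightarrow> 'a mpoly fract) k l"
        unfolding ratio_def by (subst minus_divide_right) (simp add: add.commute)
      ultimately have "T k + T l = ratio xvar k l * (A k - A l)"
        by (simp add: right_diff_distrib)
      then show ?thesis by (simp add: ratio_def)
    qed
    moreover have "P_pow (a # as) S = sum T R + (T k + T l)"
    proof -
      have "S = insert k (insert l R)" "k \<notin> insert l R" "l \<notin> R" "finite R"
        using kl assms(1) Cons.prems by (auto simp: R_def)
      then have "sum T S = sum T R + (T k + T l)" by (simp add: ac_simps)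
      then show ?thesis by (simp add: T_def)
    qed
    ultimately have "spec \<sigma> (P_pow (a # as) S) (sum U R + (xvar (\<tau> k) + xvar (\<tau> l)) * V)"
      using U by (simp add: spec_add spec_sum)
    then show "\<exists>G. spec \<sigma> (P_pow (a # as) S) G" by blast
  qed
qed

text \<open>
  Fractions whose denominator is a product of differences of distinct variables; they form a ring.
\<close>

definition clearable :: "'a::idom mpoly fract \<Rightarrow> bool" where
  "clearable F \<longleftrightarrow> (\<exists>ps. (\<forall>(k,l)\<in>set ps. k \<noteq> l) \<and>
     F * (\<Prod>(k,l)\<leftarrow>ps. xvar k - xvar l) \<in> range to_fract)"

lemma denominator_to_fract:
  "(\<Prod>(k,l)\<leftarrow>ps. xvar k - xvar l) = to_fract (\<Prod>(k,l)\<leftarrow>ps. Var k - Var l)"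
  by (induction ps) (auto simp: xvar_to_fract)

lemma clearable_to_fract: "clearable (to_fract p)"
  unfolding clearable_def by (rule exI[of _ "[]"]) auto

lemma clearable_mult:
  assumes "clearable F" "clearable G" shows "clearable (F * G)"
proof -
  from assms obtain ps qs p q where *: "\<forall>(k,l)\<in>set ps. k \<noteq> l" "\<forall>(k,l)\<in>set qs. k \<noteq> l"
    "F * (\<Prod>(k,l)\<leftarrow>ps. xvar k - xvar l) = to_fract p" "G * (\<Prod>(k,l)\<leftarrow>qs. xvar k - xvar l) = to_fract q"
    unfolding clearable_def by blast
  have eq: "F * G * (\<Prod>(k,l)\<leftarrow>ps @ qs. xvar k - xvar l) =
      (F * (\<Prod>(k,l)\<leftarrow>ps. xvar k - xvar l)) * (G * (\<Prod>(k,l)\<leftarrow>qs. xvar k - xvar l))"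
    by (simp add: mult_ac)
  have "\<dots> = to_fract (p * q)" by (simp add: *)
  then have "F * G * (\<Prod>(k,l)\<leftarrow>ps @ qs. xvar k - xvar l) \<in> range to_fract"
    unfolding eq by (rule range_eqI)
  then show ?thesis unfolding clearable_def using *(1,2) by (intro exI[of _ "ps @ qs"]) auto
qed

lemma clearable_add:
  assumes "clearable F" "clearable G" shows "clearable (F + G)"
proof -
  from assms obtain ps qs p q where *: "\<forall>(k,l)\<in>set ps. k \<noteq> l" "\<forall>(k,l)\<in>set qs. k \<noteq> l"
    "F * (\<Prod>(k,l)\<leftarrow>ps. xvar k - xvar l) = to_fract p" "G * (\<Prod>(k,l)\<leftarrow>qs. xvar k - xvar l) = to_fract q"
    unfolding clearable_def by blast
  have eq: "(F + G) * (\<Prod>(k,l)\<leftarrow>ps @ qs. xvar k - xvar l) =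
      (F * (\<Prod>(k,l)\<leftarrow>ps. xvar k - xvar l)) * (\<Prod>(k,l)\<leftarrow>qs. xvar k - xvar l)
      + (G * (\<Prod>(k,l)\<leftarrow>qs. xvar k - xvar l)) * (\<Prod>(k,l)\<leftarrow>ps. xvar k - xvar l)"
    by (simp add: algebra_simps)
  have "\<dots> = to_fract (p * (\<Prod>(k,l)\<leftarrow>qs. Var k - Var l) + q * (\<Prod>(k,l)\<leftarrow>ps. Var k - Var l))"
    unfolding * by (simp add: denominator_to_fract)
  then have "(F + G) * (\<Prod>(k,l)\<leftarrow>ps @ qs. xvar k - xvar l) \<in> range to_fract"
    unfolding eq by (rule range_eqI)
  then show ?thesis unfolding clearable_def using *(1,2) by (intro exI[of _ "ps @ qs"]) auto
qed

lemma clearable_sum: "(\<And>i. i \<in> I \<Longrightarrow> clearable (F i)) \<Longrightarrow> clearable (sum F I)"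
  by (induction I rule: infinite_finite_induct)
    (use clearable_to_fract[of 0] in \<open>auto simp: clearable_add\<close>)

lemma clearable_prod: "(\<And>i. i \<in> I \<Longrightarrow> clearable (F i)) \<Longrightarrow> clearable (prod F I)"
  by (induction I rule: infinite_finite_induct)
    (use clearable_to_fract[of 1] in \<open>auto simp: clearable_mult\<close>)

lemma clearable_ratio:
  assumes "i \<noteq> j" shows "clearable (ratio xvar i j)"
  unfolding clearable_def
proof (intro exI[of _ "[(i, j)]"] conjI)
  have "ratio xvar i j * (\<Prod>(k,l)\<leftarrow>[(i, j)]. xvar k - xvar l) = to_fract (Var i + Var j)"
    using assms by (simp add: ratio_def) (simp add: xvar_to_fract)
  then show "ratio xvar i j * (\<Prod>(k,l)\<leftarrow>[(i, j)]. xvar k - xvar l) \<in> range to_fract" by (metis rangeI)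
qed (use assms in auto)

lemma clearable_P_pow: "clearable (P_pow as S)"
proof (induction as arbitrary: S)
  case Nil
  then show ?case using clearable_to_fract[of 1] by simp
next
  case (Cons a as)
  have "clearable (\<Prod>k<a. xvar i)" for i
    unfolding xvar_to_fract by (intro clearable_prod clearable_to_fract)
  then have "clearable (xvar i ^ a)" for i by simp
  then show ?case
    unfolding list.map P_sum.simps
    by (intro clearable_sum clearable_mult clearable_prod clearable_ratio Cons.IH) auto
qed

text \<open>
  The factors of the denominator are cancelled one at a time: multiplying by the others does not
  create a pole along the diagonal of the factor in question.
\<close>

lemma regular_clearable_imp_polynomial:
  fixes F :: "'a::idom mpoly fract"
  assumes reg: "\<And>k l. k \<noteq> l \<Longrightarrow> \<exists>G. spec (Var(k := Var l)) F G" and "clearable F"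
  shows "F \<in> range to_fract"
proof -
  obtain ps where "\<forall>(k,l)\<in>set ps. k \<noteq> l" "F * (\<Prod>(k,l)\<leftarrow>ps. xvar k - xvar l) \<in> range to_fract"
    using assms(2) unfolding clearable_def by blast
  then show ?thesis
  proof (induction ps)
    case (Cons p ps)
    obtain k l where p: "p = (k, l)" by (cases p)
    with Cons.prems have kl: "k \<noteq> l" by simp
    let ?D = "\<Prod>(k,l)\<leftarrow>ps. xvar k - xvar l :: 'a mpoly fract"
    obtain G where "spec (Var(k := Var l)) F G" using reg[OF kl] by blast
    from spec_mult[OF this spec_to_fract]
    obtain H where H: "spec (Var(k := Var l)) (F * ?D) H" by (auto simp: denominator_to_fract)
    have "F * ?D * (xvar k - xvar l) \<in> range to_fract"
      using Cons.prems(2) by (simp add: p mult_ac)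
    from polynomial_cancel_difference[OF kl H this] Cons show ?case by auto
  qed simp
qed

lemma P_pow_polynomial: "finite S \<Longrightarrow> P_pow as S \<in> range to_fract"
  by (intro regular_clearable_imp_polynomial regular_on_diagonal clearable_P_pow)

text \<open>
  For positive exponents a single additional variable can be set to $0$. An exponent $0$ would let
  terms survive in which that variable fills a slot, and such sums depend on the parity of the
  number of variables.
\<close>

lemma P_pow_stable:
  assumes "0 \<notin> set as"
  obtains p :: "nat \<Rightarrow> 'a::idom mpoly"
  where "\<And>N. to_fract (p N) = P_pow as {..<N}" "\<And>N. restrict_vars N (p (Suc N)) = p N"
proof -
  have "\<exists>q. to_fract q = (P_pow as {..<N} :: 'a mpoly fract)" for N
    using P_pow_polynomial[of "{..<N}" as] by (metis finite_lessThan imageE)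
  then obtain p :: "nat \<Rightarrow> 'a mpoly" where p: "to_fract (p N) = P_pow as {..<N}" for N by metis
  have "restrict_vars N (p (Suc N)) = p N" for N
  proof -
    let ?\<sigma> = "\<lambda>i. if i < N then Var i else 0 :: 'a mpoly"
    have "spec ?\<sigma> (P_pow as {..<Suc N}) (P_pow as {..<N})"
      unfolding lessThan_Suc by (rule spec_set_variable_to_zero) (use assms in auto)
    moreover have "spec ?\<sigma> (P_pow as {..<Suc N}) (to_fract (restrict_vars N (p (Suc N))))"
      unfolding restrict_vars_def p[symmetric] by (rule spec_to_fract)
    ultimately have "to_fract (p N) = to_fract (restrict_vars N (p (Suc N)))"
      unfolding p by (rule spec_unique)
    then show ?thesis by simp
  qed
  with p that show ?thesis by blast
qed

section \<open>Comparison with the sum over permutations\<close>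

text \<open>
  The summand that belongs to the order \<open>w\<close> in which the variables fill the slots, built so that
  peeling off the first slot matches the recursion of \<open>P_sum\<close>. Surplus variables at the end of
  \<open>w\<close> enter only through the products of ratios.
\<close>

fun word_term :: "(nat \<Rightarrow> 'f::field) \<Rightarrow> (nat \<Rightarrow> 'f) list \<Rightarrow> nat list \<Rightarrow> 'f" where
  "word_term x [] w = 1"
| "word_term x (f # fs) [] = 0"
| "word_term x (f # fs) (i # w) = f i * (\<Prod>j\<in>set w. ratio x i j) * word_term x fs w"

text \<open>
  Each filling of the distinguished slots is counted once for every order of the remaining
  variables.
\<close>

lemma sum_word_term:
  assumes "finite S"
  shows "(\<Sum>w\<in>permutations_of_set S. word_term x fs w) = of_nat (fact (card S - length fs)) * P_sum x fs S"
  using assms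
proof (induction fs arbitrary: S)
  case Nil
  then show ?case by simp
next
  case (Cons f fs)
  show ?case
  proof (cases "S = {}")
    case False
    have "(\<Sum>w\<in>permutations_of_set S. word_term x (f # fs) w)
        = (\<Sum>i\<in>S. \<Sum>w\<in>(#) i ` permutations_of_set (S - {i}). word_term x (f # fs) w)"
      unfolding permutations_of_set_nonempty[OF False]
      by (rule sum.UNION_disjoint) (use Cons.prems in auto)
    also have "\<dots> = (\<Sum>i\<in>S. \<Sum>w\<in>permutations_of_set (S - {i}).
        f i * (\<Prod>j\<in>S - {i}. ratio x i j) * word_term x fs w)"
    proof (rule sum.cong[OF refl])
      fix i
      have "sum (word_term x (f # fs)) ((#) i ` permutations_of_set (S - {i}))
          = (\<Sum>w\<in>permutations_of_set (S - {i}). word_term x (f # fs) (i # w))"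
        by (simp add: sum.reindex)
      also have "\<dots> = (\<Sum>w\<in>permutations_of_set (S - {i}).
          f i * (\<Prod>j\<in>S - {i}. ratio x i j) * word_term x fs w)"
        by (intro sum.cong refl) (simp add: permutations_of_set_def)
      finally show "sum (word_term x (f # fs)) ((#) i ` permutations_of_set (S - {i})) =
          (\<Sum>w\<in>permutations_of_set (S - {i}).
            f i * (\<Prod>j\<in>S - {i}. ratio x i j) * word_term x fs w)" .
    qed
    also have "\<dots> = (\<Sum>i\<in>S. f i * (\<Prod>j\<in>S - {i}. ratio x i j) *
        (of_nat (fact (card (S - {i}) - length fs)) * P_sum x fs (S - {i})))"
      using Cons by (simp flip: sum_distrib_left)
    also have "\<dots> = (\<Sum>i\<in>S. of_nat (fact (card S - length (f # fs))) *
        (f i * (\<Prod>j\<in>S - {i}. ratio x i j) * P_sum x fs (S - {i})))"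
      using Cons.prems by (intro sum.cong refl) (simp add: mult_ac)
    finally show ?thesis by (simp add: sum_distrib_left)
  qed simp
qed

lemma bij_betw_permutes_words:
  "bij_betw (\<lambda>\<pi>. map \<pi> [0..<N]) {\<pi>. \<pi> permutes {..<N}} (permutations_of_set {..<N})"
proof -
  have inj: "inj_on (\<lambda>\<pi>. map \<pi> [0..<N]) {\<pi>. \<pi> permutes {..<N}}"
  proof (rule inj_onI, rule ext)
    fix \<pi> \<rho> i assume "\<pi> \<in> {\<pi>. \<pi> permutes {..<N}}" "\<rho> \<in> {\<pi>. \<pi> permutes {..<N}}"
      "map \<pi> [0..<N] = map \<rho> [0..<N]"
    then show "\<pi> i = \<rho> i"
      by (cases "i < N") (auto simp: permutes_def)
  qed
  have sub: "(\<lambda>\<pi>. map \<pi> [0..<N]) ` {\<pi>. \<pi> permutes {..<N}} \<subseteq> permutations_of_set {..<N}"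
  proof safe
    fix \<pi> assume "\<pi> permutes {..<N}"
    then show "map \<pi> [0..<N] \<in> permutations_of_set {..<N}"
      by (intro permutations_of_setI)
        (auto simp: distinct_map permutes_inj_on permutes_image atLeast0LessThan)
  qed
  have "card ((\<lambda>\<pi>. map \<pi> [0..<N]) ` {\<pi>. \<pi> permutes {..<N}}) = card (permutations_of_set {..<N})"
    by (simp add: card_image[OF inj] card_permutations)
  with inj sub show ?thesis
    by (intro bij_betw_imageI card_subset_eq) simp_all
qed

lemma word_term_map:
  assumes "\<pi> permutes {..<N}" "s \<le> l" "l \<le> N"
  shows "word_term x (map g [s..<l]) (map \<pi> [s..<N]) =
    (\<Prod>i\<in>{s..<l}. g i (\<pi> i)) * (\<Prod>i\<in>{s..<l}. \<Prod>j\<in>{i<..<N}. ratio x (\<pi> i) (\<pi> j))"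
  using assms(2)
proof (induction s rule: inc_induct)
  case base
  show ?case by simp
next
  case (step s)
  have "map \<pi> [s..<N] = \<pi> s # map \<pi> [Suc s..<N]" "map g [s..<l] = g s # map g [Suc s..<l]"
    using step.hyps assms(3) by (auto simp: upt_conv_Cons)
  moreover have "set (map \<pi> [Suc s..<N]) = \<pi> ` {s<..<N}"
    by (auto simp: Suc_le_eq)
  moreover have "(\<Prod>j\<in>\<pi> ` {s<..<N}. ratio x (\<pi> s) j) = (\<Prod>j\<in>{s<..<N}. ratio x (\<pi> s) (\<pi> j))"
    using permutes_inj_on[OF assms(1)] by (simp add: prod.reindex)
  moreover have "{s..<l} = insert s {Suc s..<l}" using step.hyps by auto
  ultimately show ?case using step.IH by (simp add: mult_ac)
qed

lemma sum_permutes_eq_P_sum: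
  assumes "l \<le> N"
  shows "(\<Sum>\<pi> | \<pi> permutes {..<N}. (\<Prod>i<l. g i (\<pi> i)) *
      (\<Prod>i<l. \<Prod>j\<in>{i<..<N}. ratio x (\<pi> i) (\<pi> j)))
    = of_nat (fact (N - l)) * P_sum x (map g [0..<l]) {..<N}"
proof -
  have "(\<Sum>\<pi> | \<pi> permutes {..<N}. (\<Prod>i<l. g i (\<pi> i)) *
      (\<Prod>i<l. \<Prod>j\<in>{i<..<N}. ratio x (\<pi> i) (\<pi> j)))
    = (\<Sum>\<pi> | \<pi> permutes {..<N}. word_term x (map g [0..<l]) (map \<pi> [0..<N]))"
    using word_term_map[of _ N 0 l x g] assms by (simp add: atLeast0LessThan)
  also have "\<dots> = (\<Sum>w\<in>permutations_of_set {..<N}. word_term x (map g [0..<l]) w)"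
    by (rule sum.reindex_bij_betw[OF bij_betw_permutes_words])
  finally show ?thesis by (simp add: sum_word_term)
qed

text \<open>
  Characteristic zero passes to the fraction field.
\<close>

lemma of_nat_fract_eq_0_iff: "(of_nat k :: 'a::{idom,ring_char_0} mpoly fract) = 0 \<longleftrightarrow> k = 0"
proof -
  have "to_fract (of_nat k :: 'a mpoly) = of_nat k" by (simp add: to_fract_def Fract_of_nat_eq)
  then show ?thesis by (metis of_nat_eq_0_iff to_fract_eq_0_iff)
qed

lemma double_P_fin_eq_P_sum:
  fixes t :: "nat \<Rightarrow> 'a::{idom,ring_char_0}"
  assumes "num_parts lam \<le> N"
  shows "double_P_fin lam t N =
    P_sum xvar (map (\<lambda>k i. shifted_power t (xvar i) (lam k)) [0..<num_parts lam]) {..<N}"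
  using sum_permutes_eq_P_sum[OF assms, of "\<lambda>k i. shifted_power t (xvar i) (lam k)" xvar]
    of_nat_fract_eq_0_iff[of "fact (N - num_parts lam)", where 'a='a]
  unfolding double_P_fin_def Let_def ratio_def by simp

lemma shifted_power_zero: "shifted_power (\<lambda>_. 0) x r = x ^ r"
  by (simp add: shifted_power_def flip: to_fract_def)

section \<open>Alternation in the slots\<close>

text \<open>
  Exchanging the roles of the variables in the first two slots only changes the sign of the ratio
  between them.
\<close>

lemma P_sum_swap_head:
  assumes "finite S"
  shows "P_sum x (f # g # fs) S = - P_sum x (g # f # fs) S"
proof -
  define W where "W f g i j = f i * g j * ratio x i j *
     (\<Prod>k\<in>S - {i} - {j}. ratio x i k * ratio x j k) * P_sum x fs (S - {i} - {j})" for f g i j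
  have expand: "P_sum x (f # g # fs) S = (\<Sum>i\<in>S. \<Sum>j\<in>S - {i}. W f g i j)" for f g
    unfolding P_sum.simps sum_distrib_left
  proof (intro sum.cong refl)
    fix i j assume "i \<in> S" "j \<in> S - {i}"
    then have "(\<Prod>k\<in>S - {i}. ratio x i k) = ratio x i j * (\<Prod>k\<in>S - {i} - {j}. ratio x i k)"
      using assms by (intro prod.remove) auto
    then show "f i * (\<Prod>k\<in>S - {i}. ratio x i k) *
        (g j * (\<Prod>k\<in>S - {i} - {j}. ratio x j k) * P_sum x fs (S - {i} - {j})) = W f g i j"
      by (simp add: W_def prod.distrib mult_ac)
  qed
  have ratio: "ratio x i j = - ratio x j i" for i j
    unfolding ratio_def by (subst minus_divide_right) (simp add: add.commute)
  have W: "W f g i j = - W g f j i" for i j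
    unfolding W_def by (subst ratio) (simp add: mult_ac Diff_insert2[symmetric] insert_commute)
  have "P_sum x (f # g # fs) S = (\<Sum>i\<in>S. \<Sum>j\<in>S - {i}. - W g f j i)"
    unfolding expand by (simp only: W[symmetric])
  also have "\<dots> = (\<Sum>i\<in>S. \<Sum>j\<in>{j\<in>S. j \<noteq> i}. - W g f j i)"
    by (intro sum.cong refl) auto
  also have "\<dots> = (\<Sum>j\<in>S. \<Sum>i\<in>{i\<in>S. j \<noteq> i}. - W g f j i)"
    by (rule sum.swap_restrict) (use assms in auto)
  also have "\<dots> = (\<Sum>j\<in>S. \<Sum>i\<in>S - {j}. - W g f j i)"
    by (intro sum.cong refl) auto
  finally show ?thesis unfolding expand by (simp add: sum_negf)
qed

lemma P_sum_swap_adjacent: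
  assumes "finite S"
  shows "P_sum x (hs @ f # g # fs) S = - P_sum x (hs @ g # f # fs) S"
  using assms
proof (induction hs arbitrary: S)
  case Nil
  then show ?case using P_sum_swap_head by simp
next
  case (Cons h hs)
  then show ?case by (simp add: sum_negf)
qed

lemma P_sum_transpose_adjacent:
  assumes "finite S" "Suc k < l"
  shows "P_sum x (map (h \<circ> Transposition.transpose k (Suc k)) [0..<l]) S = - P_sum x (map h [0..<l]) S"
proof -
  have split: "[0..<l] = [0..<k] @ k # Suc k # [Suc (Suc k)..<l]"
    using assms(2) upt_add_eq_append[of 0 k "l - k"] by (simp add: upt_conv_Cons)
  have 1: "map (h \<circ> Transposition.transpose k (Suc k)) [0..<k] = map h [0..<k]"
    "map (h \<circ> Transposition.transpose k (Suc k)) [Suc (Suc k)..<l] = map h [Suc (Suc k)..<l]"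
    by (auto simp: transpose_def)
  have "map (h \<circ> Transposition.transpose k (Suc k)) [0..<l]
      = map h [0..<k] @ h (Suc k) # h k # map h [Suc (Suc k)..<l]"
    unfolding split map_append list.map 1 by simp
  also have "P_sum x \<dots> S = - P_sum x (map h [0..<k] @ h k # h (Suc k) # map h [Suc (Suc k)..<l]) S"
    by (rule P_sum_swap_adjacent[OF assms(1)])
  finally show ?thesis unfolding split by simp
qed

text \<open>
  Every transposition is a product of an odd number of adjacent ones:
  $(a\;b{+}1) = (b\;b{+}1)\,(a\;b)\,(b\;b{+}1)$.
\<close>

lemma P_sum_transpose_less:
  assumes "finite S" "a < b" "b < l"
  shows "P_sum x (map (h \<circ> Transposition.transpose a b) [0..<l]) S = - P_sum x (map h [0..<l]) S"
proof -
  have "Suc a \<le> b" using assms by simp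
  then show ?thesis using assms(3)
  proof (induction b arbitrary: h rule: dec_induct)
    case base
    then show ?case by (rule P_sum_transpose_adjacent[OF assms(1)])
  next
    case (step b)
    let ?s = "Transposition.transpose b (Suc b)"
    have "Transposition.transpose a (Suc b) = ?s \<circ> Transposition.transpose a b \<circ> ?s"
      using step.hyps by (auto simp: fun_eq_iff transpose_def)
    then have "h \<circ> Transposition.transpose a (Suc b) = ((h \<circ> ?s) \<circ> Transposition.transpose a b) \<circ> ?s"
      by (simp add: comp_assoc)
    moreover have adj: "P_sum x (map (h' \<circ> ?s) [0..<l]) S = - P_sum x (map h' [0..<l]) S" for h'
      using step.prems by (intro P_sum_transpose_adjacent[OF assms(1)])
    ultimately show ?case
      using step.IH[of "h \<circ> ?s"] step.prems by (simp only: Suc_lessD adj minus_minus)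
  qed
qed

lemma P_sum_transpose:
  assumes "finite S" "a < l" "b < l" "a \<noteq> b"
  shows "P_sum x (map (h \<circ> Transposition.transpose a b) [0..<l]) S = - P_sum x (map h [0..<l]) S"
proof (cases "a < b")
  case True
  then show ?thesis using P_sum_transpose_less assms by metis
next
  case False
  then show ?thesis using P_sum_transpose_less[of S b a l x h] assms by (simp add: transpose_commute)
qed

lemma P_sum_permute:
  assumes "finite S" "\<sigma> permutes {..<l}"
  shows "P_sum x (map (h \<circ> \<sigma>) [0..<l]) S = of_int (sign \<sigma>) * P_sum x (map h [0..<l]) S"
  using assms(2) finite_lessThan
proof (induction \<sigma> arbitrary: h rule: permutes_induct)
  case id
  show ?case by (simp add: sign_id)
next
  case (swap a b \<sigma>)
  have "sign (Transposition.transpose a b \<circ> \<sigma>) = - sign \<sigma>"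
    using swap.hyps permutes_imp_permutation[OF finite_lessThan swap.hyps(4)]
    by (simp add: sign_compose permutation_swap_id sign_swap_id)
  moreover have "P_sum x (map (h \<circ> (Transposition.transpose a b \<circ> \<sigma>)) [0..<l]) S
      = of_int (sign \<sigma>) * P_sum x (map (h \<circ> Transposition.transpose a b) [0..<l]) S"
    using swap.IH[of "h \<circ> Transposition.transpose a b"] by (simp only: comp_assoc)
  ultimately show ?case
    using P_sum_transpose[OF assms(1), of a l b x h] swap.hyps by (simp only: lessThan_iff) simp
qed

section \<open>A constant in the last slot\<close>

text \<open>
  For a monic polynomial $f$ of degree at most $|A|-1$, given by its list of roots, the sum of
  $f(p)/\prod_{q \ne p}(p-q)$ over the nodes $p \in A$ is the coefficient of $f$ in degree $|A|-1$, by
  Lagrange interpolation. The induction uses that a root $b \in A$ removes the node $b$, and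
  trades any root $y$ for such a root by writing $z-y = (z-b)+(b-y)$.
\<close>

lemma Lagrange_sum:
  fixes A :: "'f::field set"
  assumes "finite A" "A \<noteq> {}" "length ys < card A"
  shows "(\<Sum>p\<in>A. (\<Prod>y\<leftarrow>ys. p - y) / (\<Prod>q\<in>A - {p}. p - q)) = (if Suc (length ys) = card A then 1 else 0)"
  using assms
proof (induction "card A" arbitrary: A ys rule: less_induct)
  case less
  define G where "G A ys = (\<Sum>p\<in>A. (\<Prod>y\<leftarrow>ys. p - y) / (\<Prod>q\<in>A - {p}. p - q))"
    for A and ys :: "'f list"
  have root: "G A (b # ys) = G (A - {b}) ys" if "b \<in> A" for b ys
  proof -
    have "G A (b # ys) = (\<Sum>p\<in>A - {b}. (\<Prod>y\<leftarrow>b # ys. p - y) / (\<Prod>q\<in>A - {p}. p - q))"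
      unfolding G_def using less.prems(1) that by (simp add: sum.remove[of A b])
    also have "\<dots> = G (A - {b}) ys"
      unfolding G_def
    proof (intro sum.cong refl)
      fix p assume p: "p \<in> A - {b}"
      then have "(\<Prod>q\<in>A - {p}. p - q) = (p - b) * (\<Prod>q\<in>A - {p} - {b}. p - q)"
        using that less.prems(1) by (intro prod.remove) auto
      moreover have "A - {p} - {b} = A - {b} - {p}" by auto
      ultimately show "(\<Prod>y\<leftarrow>b # ys. p - y) / (\<Prod>q\<in>A - {p}. p - q) =
          (\<Prod>y\<leftarrow>ys. p - y) / (\<Prod>q\<in>A - {b} - {p}. p - q)"
        using p by simp
    qed
    finally show ?thesis .
  qed
  have linear: "G A (y # ys) = G A (b # ys) + (b - y) * G A ys" for y b ys
    unfolding G_def sum_distrib_left sum.distrib[symmetric]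
    by (intro sum.cong refl) (simp add: add_divide_distrib[symmetric] algebra_simps)
  have IH: "G (A - {b}) ys = (if Suc (length ys) = card (A - {b}) then 1 else 0)"
    if "b \<in> A" "Suc (length ys) < card A" for b ys
    unfolding G_def using that less.prems(1) by (intro less.hyps) (auto simp: card_Diff_singleton dest!: subset_singletonD)
  \<comment> \<open>Two different nodes $a$ and $b$ give the same value for $f\,(z-a)$ and $f\,(z-b)$, and these differ by $(b-a)\,G$.\<close>
  have zero: "G A ys = 0" if lt: "Suc (length ys) < card A" for ys
  proof -
    have "\<not> card A \<le> 1" using lt by simp
    then obtain a b where ab: "a \<in> A" "b \<in> A" "a \<noteq> b"
      using card_le_Suc0_iff_eq[OF less.prems(1)] by auto
    have "G (A - {a}) ys = G (A - {b}) ys"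
      using ab IH[OF _ lt] less.prems(1) by simp
    then have "(b - a) * G A ys = 0"
      using linear[of a ys b] root ab by simp
    with ab show ?thesis by simp
  qed
  show ?case
  proof (cases "Suc (length ys) = card A")
    case False
    with less.prems zero[of ys] show ?thesis by (simp add: G_def)
  next
    case True
    show ?thesis
    proof (cases ys)
      case Nil
      with True obtain p where "A = {p}" by (metis One_nat_def card_1_singletonE list.size(3))
      with Nil show ?thesis by simp
    next
      case (Cons y ys')
      obtain b where b: "b \<in> A" using less.prems by auto
      have "G A ys = G (A - {b}) ys'"
        using linear[of y ys' b] root[OF b] zero[of ys'] True Cons by simp
      also have "\<dots> = 1" using IH[OF b, of ys'] True Cons b less.prems(1) by simp
      finally show ?thesis using True by (simp add: G_def)
    qed
  qed
qed

text \<open>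
  Lagrange interpolation of $f(z) = \prod_j (z+x_j)$ at the points $x_i$ and at the additional
  point $0$: each $x_i$ contributes twice the summand here, $0$ contributes $(-1)^{|S|}$,
  and the total is $1$.
\<close>

lemma sum_prod_ratio:
  fixes x :: "nat \<Rightarrow> 'f::field"
  assumes "finite S" "inj_on x S" "0 \<notin> x ` S" "(2::'f) \<noteq> 0"
  shows "(\<Sum>i\<in>S. \<Prod>j\<in>S - {i}. ratio x i j) = (if odd (card S) then 1 else 0)"
proof -
  obtain ns where ns: "set ns = S" "distinct ns" using finite_distinct_list[OF assms(1)] by auto
  define ys where "ys = map (\<lambda>j. - x j) ns"
  define A where "A = insert 0 (x ` S)"
  have card: "card A = Suc (card S)"
    using assms by (simp add: A_def card_image)
  have f: "(\<Prod>y\<leftarrow>ys. p - y) = (\<Prod>j\<in>S. p + x j)" for p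
    unfolding ys_def using ns by (simp add: o_def prod.distinct_set_conv_list flip: ns(1))
  have len: "length ys = card S" using ns distinct_card[of ns] by (simp add: ys_def)
  have "(\<Prod>j\<in>S. x i + x j) / (\<Prod>q\<in>A - {x i}. x i - q) = 2 * (\<Prod>j\<in>S - {i}. ratio x i j)"
    if i: "i \<in> S" for i
  proof -
    have xi: "x i \<noteq> 0" using assms(3) i by auto
    have "A - {x i} = insert 0 (x ` (S - {i}))" "0 \<notin> x ` (S - {i})"
      using assms(2,3) i xi by (auto simp: A_def inj_on_def)
    moreover have "inj_on x (S - {i})" using assms(2) by (rule inj_on_subset) auto
    ultimately have "(\<Prod>q\<in>A - {x i}. x i - q) = x i * (\<Prod>j\<in>S - {i}. x i - x j)"
      using assms(1) by (simp add: prod.reindex)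
    moreover have "(\<Prod>j\<in>S. x i + x j) = 2 * x i * (\<Prod>j\<in>S - {i}. x i + x j)"
      using assms(1) i by (simp add: prod.remove[of S i])
    ultimately show ?thesis using xi by (simp add: ratio_def prod_dividef)
  qed
  moreover have "(\<Prod>j\<in>S. 0 + x j) / (\<Prod>q\<in>A - {0}. 0 - q) = (- 1) ^ card S"
  proof -
    have "A - {0} = x ` S" using assms(3) by (auto simp: A_def)
    then have "(\<Prod>q\<in>A - {0}. 0 - q) = (\<Prod>j\<in>S. (- 1) * x j)"
      using assms(2) by (simp add: prod.reindex)
    then have "(\<Prod>q\<in>A - {0}. 0 - q) = (- 1) ^ card S * (\<Prod>j\<in>S. x j)"
      by (simp only: prod.distrib prod_constant)
    moreover have "(\<Prod>j\<in>S. x j) \<noteq> 0" using assms(1,3) by (auto simp: image_iff)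
    ultimately show ?thesis by (simp add: divide_simps flip: power_mult_distrib)
  qed
  moreover have "(\<Sum>p\<in>A. (\<Prod>y\<leftarrow>ys. p - y) / (\<Prod>q\<in>A - {p}. p - q)) = 1"
    using Lagrange_sum[of A ys] card len assms(1) by (simp add: A_def)
  ultimately have "(- 1) ^ card S + 2 * (\<Sum>i\<in>S. \<Prod>j\<in>S - {i}. ratio x i j) = 1"
    unfolding f using assms(1-3) by (simp add: A_def sum.reindex sum_distrib_left)
  then show ?thesis using assms(4) by (cases "odd (card S)") (auto simp: algebra_simps)
qed

lemma P_sum_trailing_one:
  fixes x :: "nat \<Rightarrow> 'f::field"
  assumes "finite S" "inj_on x S" "0 \<notin> x ` S" "(2::'f) \<noteq> 0" "length fs \<le> card S"
  shows "P_sum x (fs @ [\<lambda>_. 1]) S = (if odd (card S - length fs) then P_sum x fs S else 0)"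
  using assms(1-3,5)
proof (induction fs arbitrary: S)
  case Nil
  then show ?case using sum_prod_ratio[of S x] assms(4) by simp
next
  case (Cons f fs)
  have "P_sum x (fs @ [\<lambda>_. 1]) (S - {i})
      = (if odd (card S - length (f # fs)) then P_sum x fs (S - {i}) else 0)" if "i \<in> S" for i
    using Cons.prems that Cons.IH[of "S - {i}"] by (auto simp: inj_on_def image_iff)
  then show ?case by simp
qed

section \<open>Elements of the projective limit\<close>

lemma even_limit_eqI:
  assumes "f \<in> even_limit" "g \<in> even_limit" and eq: "\<And>m. l \<le> 2 * m \<Longrightarrow> f m = g m"
  shows "f = g"
proof
  fix m
  have "f (m + k) = g (m + k) \<Longrightarrow> f m = g m" for k
  proof (induction k)
    case (Suc k)
    have "f (m + k) = restrict_vars (2 * (m + k)) (f (Suc (m + k)))"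
      "g (m + k) = restrict_vars (2 * (m + k)) (g (Suc (m + k)))"
      using assms(1,2)[unfolded even_limit_def mem_Collect_eq, rule_format, of "m + k"] by (simp_all only:)
    with Suc show ?case by simp
  qed simp
  from this[of l] show "f m = g m" by (simp add: eq)
qed

lemma double_P_eqI:
  assumes "f \<in> even_limit"
    and "\<And>m. num_parts lam \<le> 2 * m \<Longrightarrow> Fract (f m) 1 = double_P_fin lam t (2 * m)"
  shows "double_P lam t = f"
  unfolding double_P_def
proof (rule the_equality)
  fix g assume g: "g \<in> even_limit \<and>
    (\<forall>m. num_parts lam \<le> 2 * m \<longrightarrow> Fract (g m) 1 = double_P_fin lam t (2 * m))"
  then have "g m = f m" if "num_parts lam \<le> 2 * m" for m
    using assms(2)[OF that] that by (metis to_fract_def to_fract_eq_iff)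
  with g assms(1) show "g = f" by (intro even_limit_eqI[of g f "num_parts lam"]) auto
qed (use assms in auto)

lemma partition_support:
  assumes "is_partition lam" shows "lam i \<noteq> 0 \<longleftrightarrow> i < num_parts lam"
proof -
  have fin: "finite {i. lam i \<noteq> 0}" and anti: "\<And>i j. i \<le> j \<Longrightarrow> lam j \<le> lam i"
    using assms by (auto simp: is_partition_def antimono_def)
  define m where "m = (LEAST i. lam i = 0)"
  have "\<exists>i. lam i = 0" using ex_new_if_finite[OF infinite_UNIV_nat fin] by auto
  then have m: "lam m = 0" unfolding m_def by (rule LeastI_ex)
  have "lam i \<noteq> 0 \<longleftrightarrow> i < m" for i
    using anti[of m i] m not_less_Least[of i "\<lambda>i. lam i = 0"] by (cases "i < m") (auto simp: m_def)
  then have "{i. lam i \<noteq> 0} = {..<m}" by auto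
  then show ?thesis by (auto simp: num_parts_def)
qed

text \<open>
  All slots hold positive exponents, so the stable family of polynomials exists in every number
  of variables; its members in an even number of variables form the required element of the limit.
\<close>

lemma schur_P_limit:
  fixes lam :: "nat \<Rightarrow> nat"
  assumes "is_partition lam"
  shows "(schur_P lam :: nat \<Rightarrow> 'a::{idom,ring_char_0} mpoly) \<in> even_limit"
    and "num_parts lam \<le> 2 * m \<Longrightarrow> to_fract (schur_P lam m :: 'a mpoly) =
      P_sum xvar (map (\<lambda>k i. xvar i ^ lam k) [0..<num_parts lam]) {..<2 * m}"
proof -
  let ?as = "map lam [0..<num_parts lam]"
  have "0 \<notin> set ?as" using partition_support[OF assms] by (metis (no_types, lifting) atLeastLessThan_iff atLeastLessThan_upt image_iff list.set_map)
  from P_pow_stable[OF this] obtain p :: "nat \<Rightarrow> 'a mpoly"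
    where p: "\<And>N. to_fract (p N) = P_pow ?as {..<N}"
      and stable: "\<And>N. restrict_vars N (p (Suc N)) = p N" by blast
  have "restrict_vars (2 * m) (p (2 * Suc m)) = p (2 * m)" for m
    using restrict_vars_restrict_vars[of "2 * m" "Suc (2 * m)" "p (2 * Suc m)"]
    by (simp add: stable)
  then have "(\<lambda>m. p (2 * m)) \<in> even_limit" by (simp add: even_limit_def)
  moreover have P: "P_pow ?as {..<N} =
    P_sum xvar (map (\<lambda>k i. xvar i ^ lam k) [0..<num_parts lam]) {..<N}" for N
    by (simp add: o_def)
  ultimately have "schur_P lam = (\<lambda>m. p (2 * m))"
    unfolding schur_P_def
    by (intro double_P_eqI)
      (simp_all add: double_P_fin_eq_P_sum shifted_power_zero p to_fract_def[symmetric] del: map_map)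
  with \<open>_ \<in> even_limit\<close> p P
  show "(schur_P lam :: nat \<Rightarrow> 'a mpoly) \<in> even_limit"
    "num_parts lam \<le> 2 * m \<Longrightarrow> to_fract (schur_P lam m :: 'a mpoly) =
      P_sum xvar (map (\<lambda>k i. xvar i ^ lam k) [0..<num_parts lam]) {..<2 * m}"
    by simp_all
qed

lemma P_sum_trailing_zero_exponent:
  assumes "Suc k \<le> N" "a k = 0"
  shows "P_sum xvar (map (\<lambda>k i. (xvar i :: 'a::{idom,ring_char_0} mpoly fract) ^ a k) [0..<Suc k]) {..<N} =
    (if odd (N - k) then P_sum xvar (map (\<lambda>k i. xvar i ^ a k) [0..<k]) {..<N} else 0)"
proof -
  have "(2 :: 'a mpoly fract) \<noteq> 0"
    using of_nat_fract_eq_0_iff[of 2, where 'a='a] by simp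
  then have "P_sum xvar (map (\<lambda>k i. (xvar i :: 'a mpoly fract) ^ a k) [0..<k] @ [\<lambda>_. 1]) {..<N} =
    (if odd (card {..<N} - length (map (\<lambda>k i. (xvar i :: 'a mpoly fract) ^ a k) [0..<k]))
     then P_sum xvar (map (\<lambda>k i. xvar i ^ a k) [0..<k]) {..<N} else 0)"
    using assms(1) by (intro P_sum_trailing_one) (auto simp: inj_on_def)
  then show ?thesis using assms(2) by simp
qed

section \<open>Expansion in powers of the variables\<close>

lemma to_fract_sum: "to_fract (sum f A) = (\<Sum>a\<in>A. to_fract (f a))"
  by (induction A rule: infinite_finite_induct) simp_all

lemma to_fract_prod: "to_fract (prod f A) = (\<Prod>a\<in>A. to_fract (f a))"
  by (induction A rule: infinite_finite_induct) simp_all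

lemma Const_sum: "Const (sum f A) = (\<Sum>a\<in>A. Const (f a))"
  by (induction A rule: infinite_finite_induct) (simp_all add: Const_add)

lemma Const_prod: "Const (prod f A) = (\<Prod>a\<in>A. Const (f a))"
  by (induction A rule: infinite_finite_induct) (simp_all add: Const_mult)

abbreviation scalar :: "'a::idom \<Rightarrow> 'a mpoly fract" where
  "scalar c \<equiv> to_fract (Const c)"

lemma scalar_sum: "scalar (sum f A) = (\<Sum>a\<in>A. scalar (f a))"
  by (simp add: Const_sum to_fract_sum)

lemma scalar_prod: "scalar (prod f A) = (\<Prod>a\<in>A. scalar (f a))"
  by (simp add: Const_prod to_fract_prod)

text \<open>
  The bound \<open>M\<close> is independent of \<open>r\<close>, so that all slots can be expanded over the same set of
  exponents; the coefficients of the superfluous powers are $e_p$ with $p<0$, hence zero.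
\<close>

lemma shifted_power_expansion:
  fixes t :: "nat \<Rightarrow> 'a::idom"
  assumes "r \<le> M"
  shows "shifted_power t x r = (\<Sum>a\<le>M. scalar (elem_sym r (int r - int a) (\<lambda>k. - t k)) * x ^ a)"
proof -
  let ?w = "\<lambda>X. \<Prod>k\<in>X. scalar (- t k)"
  have card: "card X \<le> r" if "X \<subseteq> {..<r}" for X
    using card_mono[OF finite_lessThan that] by simp
  have "shifted_power t x r = (\<Prod>k<r. scalar (- t k) + x)"
    by (simp add: shifted_power_def Const_uminus flip: to_fract_def)
  also have "\<dots> = (\<Sum>X\<in>Pow {..<r}. ?w X * x ^ card ({..<r} - X))"
    by (simp add: prod_add)
  also have "\<dots> = (\<Sum>X\<in>Pow {..<r}. ?w X * x ^ (r - card X))"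
    by (intro sum.cong refl) (simp add: card_Diff_subset finite_subset[of _ "{..<r}"])
  also have "\<dots> = (\<Sum>a\<le>M. \<Sum>X | X \<in> Pow {..<r} \<and> r - card X = a. ?w X * x ^ (r - card X))"
    using assms by (intro sum.group[symmetric]) auto
  also have "\<dots> = (\<Sum>a\<le>M. scalar (elem_sym r (int r - int a) (\<lambda>k. - t k)) * x ^ a)"
  proof (intro sum.cong refl)
    fix a
    have "{X. X \<in> Pow {..<r} \<and> r - card X = a} = {X. X \<subseteq> {..<r} \<and> int (card X) = int r - int a}"
      using card by force
    then show "(\<Sum>X | X \<in> Pow {..<r} \<and> r - card X = a. ?w X * x ^ (r - card X)) =
        scalar (elem_sym r (int r - int a) (\<lambda>k. - t k)) * x ^ a"
      unfolding elem_sym_def scalar_sum scalar_prod sum_distrib_right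
      by (intro sum.cong) auto
  qed
  finally show ?thesis .
qed

text \<open>
  Linearity in the slots is immediate for the sum over permutations, which differs from \<open>P_sum\<close> by
  a nonzero factor.
\<close>

lemma P_sum_multilinear:
  fixes x :: "nat \<Rightarrow> 'f::field"
  assumes "l \<le> N" "(of_nat (fact (N - l)) :: 'f) \<noteq> 0" "finite A"
  shows "P_sum x (map (\<lambda>k i. \<Sum>a\<in>A. c k a * h a i) [0..<l]) {..<N} =
    (\<Sum>a\<in>{..<l} \<rightarrow>\<^sub>E A. (\<Prod>k<l. c k (a k)) * P_sum x (map (\<lambda>k. h (a k)) [0..<l]) {..<N})"
proof -
  let ?K = "\<lambda>\<pi>. \<Prod>i<l. \<Prod>j\<in>{i<..<N}. ratio x (\<pi> i) (\<pi> j)"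
  have "of_nat (fact (N - l)) * P_sum x (map (\<lambda>k i. \<Sum>a\<in>A. c k a * h a i) [0..<l]) {..<N}
     = (\<Sum>\<pi> | \<pi> permutes {..<N}. (\<Prod>k<l. \<Sum>a\<in>A. c k a * h a (\<pi> k)) * ?K \<pi>)"
    by (rule sum_permutes_eq_P_sum[OF assms(1), symmetric])
  also have "\<dots> = (\<Sum>\<pi> | \<pi> permutes {..<N}. \<Sum>a\<in>{..<l} \<rightarrow>\<^sub>E A.
      (\<Prod>k<l. c k (a k)) * ((\<Prod>k<l. h (a k) (\<pi> k)) * ?K \<pi>))"
    using assms(3) by (simp add: prod_sum_PiE prod.distrib sum_distrib_right mult.assoc)
  also have "\<dots> = (\<Sum>a\<in>{..<l} \<rightarrow>\<^sub>E A. (\<Prod>k<l. c k (a k)) *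
      (\<Sum>\<pi> | \<pi> permutes {..<N}. (\<Prod>k<l. h (a k) (\<pi> k)) * ?K \<pi>))"
    by (subst sum.swap) (simp add: sum_distrib_left)
  also have "\<dots> = of_nat (fact (N - l)) * (\<Sum>a\<in>{..<l} \<rightarrow>\<^sub>E A. (\<Prod>k<l. c k (a k)) *
      P_sum x (map (\<lambda>k. h (a k)) [0..<l]) {..<N})"
    unfolding sum_permutes_eq_P_sum[OF assms(1), of "\<lambda>k. h (_ k)"]
    by (simp add: sum_distrib_left mult_ac)
  finally show ?thesis using assms(2) by simp
qed

section \<open>Collecting rearrangements\<close>

text \<open>
  Extending the sequences by $0$ beyond \<open>l\<close> makes them determined by their first \<open>l\<close> entries
  and directly comparable with partitions.
\<close>

definition decreasing_seqs :: "nat \<Rightarrow> nat \<Rightarrow> (nat \<Rightarrow> nat) set" where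
  "decreasing_seqs l M = {\<kappa>. (\<forall>i<l. \<kappa> i \<le> M) \<and> (\<forall>i j. i < j \<longrightarrow> j < l \<longrightarrow> \<kappa> j < \<kappa> i) \<and> (\<forall>i\<ge>l. \<kappa> i = 0)}"

lemma decreasing_seqs_eqI:
  assumes "\<kappa> \<in> decreasing_seqs l M" "\<kappa>' \<in> decreasing_seqs l M'" "\<kappa> ` {..<l} = \<kappa>' ` {..<l}"
  shows "\<kappa> = \<kappa>'"
proof -
  have sorted: "sorted_wrt (<) (rev (map \<kappa> [0..<l]))" if "\<kappa> \<in> decreasing_seqs l M" for \<kappa> M
    using that unfolding sorted_wrt_rev sorted_wrt_map
    by (auto simp: sorted_wrt_iff_nth_less decreasing_seqs_def)
  have "rev (map \<kappa> [0..<l]) = rev (map \<kappa>' [0..<l])"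
    using assms by (intro strict_sorted_equal sorted) (simp_all add: atLeast0LessThan)
  then have "\<kappa> i = \<kappa>' i" if "i < l" for i
    using that by simp
  moreover have "\<kappa> i = 0 \<and> \<kappa>' i = 0" if "\<not> i < l" for i
    using assms(1,2) that by (simp add: decreasing_seqs_def)
  ultimately have "\<kappa> i = \<kappa>' i" for i by (cases "i < l") simp_all
  then show ?thesis by (rule ext)
qed

lemma decreasing_seqs_inj:
  assumes "\<kappa> \<in> decreasing_seqs l M"
  shows "inj_on \<kappa> {..<l}"
proof (rule inj_onI)
  fix i j assume ij: "i \<in> {..<l}" "j \<in> {..<l}" "\<kappa> i = \<kappa> j"
  have dec: "\<kappa> q < \<kappa> p" if "p < q" "q < l" for p q
    using assms that by (simp add: decreasing_seqs_def)
  show "i = j"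
    using dec[of i j] dec[of j i] ij by (cases i j rule: linorder_cases) simp_all
qed

lemma finite_decreasing_seqs: "finite (decreasing_seqs l M)"
proof -
  have "decreasing_seqs l M \<subseteq> {f. \<forall>i. (i \<in> {..<l} \<longrightarrow> f i \<in> {..M}) \<and> (i \<notin> {..<l} \<longrightarrow> f i = 0)}"
    by (auto simp: decreasing_seqs_def)
  then show ?thesis
    using finite_set_of_finite_funs[of "{..<l}" "{..M}" 0] by (auto intro: finite_subset)
qed

text \<open>
  A sequence of distinct numbers is sorted by a unique permutation.
\<close>

lemma bij_betw_sort_injection:
  "bij_betw (\<lambda>(\<kappa>, \<sigma>). restrict (\<kappa> \<circ> \<sigma>) {..<l}) (decreasing_seqs l M \<times> {\<sigma>. \<sigma> permutes {..<l}})
     {a \<in> {..<l} \<rightarrow>\<^sub>E {..M}. inj_on a {..<l}}"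
  (is "bij_betw ?f ?A ?B")
proof (rule bij_betw_imageI)
  show "inj_on ?f ?A"
  proof (rule inj_onI, clarify)
    fix \<kappa> \<sigma> \<kappa>' \<sigma>'
    assume *: "\<kappa> \<in> decreasing_seqs l M" "\<kappa>' \<in> decreasing_seqs l M"
      "\<sigma> permutes {..<l}" "\<sigma>' permutes {..<l}"
      "restrict (\<kappa> \<circ> \<sigma>) {..<l} = restrict (\<kappa>' \<circ> \<sigma>') {..<l}"
    have eq: "\<kappa> (\<sigma> i) = \<kappa>' (\<sigma>' i)" if "i < l" for i
      using fun_cong[OF *(5), of i] that by simp
    have "\<kappa> ` \<sigma> ` {..<l} = \<kappa>' ` \<sigma>' ` {..<l}"
      unfolding image_image using eq by (intro image_cong) auto
    then have "\<kappa> = \<kappa>'"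
      by (intro decreasing_seqs_eqI[OF *(1,2)]) (simp only: permutes_image[OF *(3)] permutes_image[OF *(4)])
    moreover have "\<sigma> i = \<sigma>' i" for i
    proof (cases "i < l")
      case True
      then have "\<sigma> i \<in> {..<l}" "\<sigma>' i \<in> {..<l}"
        unfolding permutes_in_image[OF *(3)] permutes_in_image[OF *(4)] by simp_all
      with eq[OF True] show ?thesis
        unfolding \<open>\<kappa> = \<kappa>'\<close> by (rule inj_onD[OF decreasing_seqs_inj[OF *(2)]])
    next
      case False
      then show ?thesis using permutes_not_in[OF *(3), of i] permutes_not_in[OF *(4), of i] by simp
    qed
    then have "\<sigma> = \<sigma>'" by (rule ext)
    ultimately show "\<kappa> = \<kappa>' \<and> \<sigma> = \<sigma>'" by (rule conjI)
  qed
  show "?f ` ?A = ?B"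
  proof (intro equalityI subsetI)
    fix a assume "a \<in> ?f ` ?A"
    then obtain \<kappa> \<sigma> where *: "\<kappa> \<in> decreasing_seqs l M" "\<sigma> permutes {..<l}"
      and a: "a = restrict (\<kappa> \<circ> \<sigma>) {..<l}" by auto
    have \<sigma>: "\<sigma> i < l" if "i < l" for i using *(2) that permutes_in_image[of \<sigma> "{..<l}" i] by simp
    have "inj_on (\<kappa> \<circ> \<sigma>) {..<l}"
      using decreasing_seqs_inj[OF *(1)]
      by (intro comp_inj_on permutes_inj_on[OF *(2)]) (simp only: permutes_image[OF *(2)])
    then have "inj_on a {..<l}" unfolding a by (simp only: inj_on_restrict_eq)
    moreover have "\<kappa> (\<sigma> i) \<le> M" if "i < l" for i
      using *(1) \<sigma>[OF that] by (simp add: decreasing_seqs_def)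
    then have "a \<in> {..<l} \<rightarrow>\<^sub>E {..M}" unfolding a by (intro restrict_PiE_iff[THEN iffD2]) simp
    ultimately show "a \<in> ?B" by simp
  next
    fix a assume "a \<in> ?B"
    then have a: "a \<in> {..<l} \<rightarrow>\<^sub>E {..M}" and inj: "inj_on a {..<l}" by auto
    define xs where "xs = rev (sorted_list_of_set (a ` {..<l}))"
    define \<kappa> where "\<kappa> i = (if i < l then xs ! i else 0)" for i
    have len: "length xs = l" using inj by (simp add: xs_def card_image)
    have set: "set xs = a ` {..<l}" by (simp add: xs_def)
    have "sorted_wrt (>) xs" by (simp add: xs_def sorted_wrt_rev)
    then have dec: "\<kappa> j < \<kappa> i" if "i < j" "j < l" for i j
      using that len by (simp add: \<kappa>_def sorted_wrt_iff_nth_less)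
    have "\<kappa> ` {..<l} = (!) xs ` {0..<length xs}"
      unfolding len atLeast0LessThan by (rule image_cong) (simp_all add: \<kappa>_def)
    also have "\<dots> = a ` {..<l}"
      unfolding nth_image[OF order_refl] take_all[OF order_refl] by (rule set)
    finally have img: "\<kappa> ` {..<l} = a ` {..<l}" .
    have "\<kappa> i \<le> M" if "i < l" for i
    proof -
      have "\<kappa> i \<in> \<kappa> ` {..<l}" using that by (rule_tac imageI) simp
      then obtain j where "j \<in> {..<l}" "\<kappa> i = a j" unfolding img by (rule imageE)
      then show ?thesis using PiE_mem[OF a, of j] by simp
    qed
    then have \<kappa>: "\<kappa> \<in> decreasing_seqs l M"
      unfolding decreasing_seqs_def using dec by (simp add: \<kappa>_def)
    define \<sigma> where "\<sigma> i = (if i < l then inv_into {..<l} \<kappa> (a i) else i)" for i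
    have bij\<kappa>: "bij_betw \<kappa> {..<l} (a ` {..<l})"
      using decreasing_seqs_inj[OF \<kappa>] img by (simp add: bij_betw_def)
    have "bij_betw (inv_into {..<l} \<kappa> \<circ> a) {..<l} {..<l}"
      by (rule bij_betw_trans[OF inj_on_imp_bij_betw[OF inj] bij_betw_inv_into[OF bij\<kappa>]])
    then have "bij_betw \<sigma> {..<l} {..<l}"
      by (subst bij_betw_cong[of _ _ "inv_into {..<l} \<kappa> \<circ> a"]) (simp_all add: \<sigma>_def)
    then have \<sigma>: "\<sigma> permutes {..<l}" by (rule bij_imp_permutes) (simp add: \<sigma>_def)
    have "\<kappa> (\<sigma> i) = a i" if "i < l" for i
      using that img by (simp add: \<sigma>_def f_inv_into_f)
    then have "a = ?f (\<kappa>, \<sigma>)" using PiE_arb[OF a] by (simp add: fun_eq_iff)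
    then show "a \<in> ?f ` ?A" using \<kappa> \<sigma> by (intro image_eqI[of _ _ "(\<kappa>, \<sigma>)"]) simp_all
  qed
qed

text \<open>
  The Cauchy-Binet mechanism: an alternating function only sees strictly decreasing arguments, and
  the coefficients of the rearrangements of one argument add up to a determinant.
\<close>

lemma sum_alternating:
  fixes F :: "(nat \<Rightarrow> nat) \<Rightarrow> 'f::comm_ring_1"
  assumes alt: "\<And>\<kappa> \<sigma>. \<sigma> permutes {..<l} \<Longrightarrow> F (\<kappa> \<circ> \<sigma>) = of_int (sign \<sigma>) * F \<kappa>"
    and zero: "\<And>a. \<not> inj_on a {..<l} \<Longrightarrow> F a = 0"
    and restr: "\<And>a. F (restrict a {..<l}) = F a"
  shows "(\<Sum>a\<in>{..<l} \<rightarrow>\<^sub>E {..M}. (\<Prod>k<l. c k (a k)) * F a) =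
    (\<Sum>\<kappa>\<in>decreasing_seqs l M.
       (\<Sum>\<sigma> | \<sigma> permutes {..<l}. of_int (sign \<sigma>) * (\<Prod>k<l. c k (\<kappa> (\<sigma> k)))) * F \<kappa>)"
proof -
  have "(\<Sum>a\<in>{..<l} \<rightarrow>\<^sub>E {..M}. (\<Prod>k<l. c k (a k)) * F a)
      = (\<Sum>a\<in>{a \<in> {..<l} \<rightarrow>\<^sub>E {..M}. inj_on a {..<l}}. (\<Prod>k<l. c k (a k)) * F a)"
    by (intro sum.mono_neutral_right) (auto simp: zero intro: finite_PiE)
  also have "\<dots> = (\<Sum>(\<kappa>, \<sigma>)\<in>decreasing_seqs l M \<times> {\<sigma>. \<sigma> permutes {..<l}}.
      (\<Prod>k<l. c k (restrict (\<kappa> \<circ> \<sigma>) {..<l} k)) * F (restrict (\<kappa> \<circ> \<sigma>) {..<l}))"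
    unfolding sum.reindex_bij_betw[OF bij_betw_sort_injection, symmetric] by (simp add: case_prod_beta)
  also have "\<dots> = (\<Sum>(\<kappa>, \<sigma>)\<in>decreasing_seqs l M \<times> {\<sigma>. \<sigma> permutes {..<l}}.
      of_int (sign \<sigma>) * (\<Prod>k<l. c k (\<kappa> (\<sigma> k))) * F \<kappa>)"
    by (intro sum.cong refl) (auto simp: restr alt[simplified comp_def] alt mult_ac)
  finally show ?thesis
    by (simp add: sum.cartesian_product[symmetric] sum_distrib_right)
qed

lemma P_sum_xvar_alternating:
  fixes N l :: nat
  defines "F \<equiv> \<lambda>a. P_sum xvar (map (\<lambda>k i. (xvar i :: 'a::{idom,ring_char_0} mpoly fract) ^ a k) [0..<l]) {..<N}"
  shows "\<sigma> permutes {..<l} \<Longrightarrow> F (a \<circ> \<sigma>) = of_int (sign \<sigma>) * F a"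
    and "\<not> inj_on a {..<l} \<Longrightarrow> F a = 0"
    and "F (restrict a {..<l}) = F a"
proof -
  show "F (a \<circ> \<sigma>) = of_int (sign \<sigma>) * F a" if "\<sigma> permutes {..<l}"
    using P_sum_permute[OF finite_lessThan that, of xvar "\<lambda>k i. xvar i ^ a k" N]
    by (simp add: F_def comp_def)
  show "F (restrict a {..<l}) = F a"
    unfolding F_def by (intro arg_cong[of _ _ "\<lambda>fs. P_sum xvar fs {..<N}"] map_cong) auto
  assume "\<not> inj_on a {..<l}"
  then obtain p q where pq: "p < l" "q < l" "p \<noteq> q" "a p = a q" by (auto simp: inj_on_def)
  \<comment> \<open>Exchanging two slots with equal exponents shows that the sum equals its own negative.\<close>
  have eq: "(\<lambda>k i. xvar i ^ a k :: 'a mpoly fract) \<circ> Transposition.transpose p q = (\<lambda>k i. xvar i ^ a k)"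
    using pq(4) by (auto simp: fun_eq_iff transpose_def)
  have "F a = - F a"
    using P_sum_transpose[OF finite_lessThan pq(1-3), of "xvar :: nat \<Rightarrow> 'a mpoly fract" "\<lambda>k i. xvar i ^ a k" N, unfolded eq]
    unfolding F_def .
  then have "F a + F a = 0" by (simp only: eq_neg_iff_add_eq_0)
  then have "of_nat 2 * F a = 0" by (simp only: of_nat_numeral mult_2)
  then show "F a = 0" using of_nat_fract_eq_0_iff[of 2, where 'a='a] by (simp only: mult_eq_0_iff) simp
qed

section \<open>The coefficient determinant\<close>

text \<open>
  The determinant of $e^{2(L-k)}_{2(L-k)-\kappa_j}(-t)$ with $L = n-1$ and rows $k$ counted from $0$,
  in terms of the exponents $\kappa$ instead of the partition $\nu$.
\<close>

definition coeff_det :: "nat \<Rightarrow> (nat \<Rightarrow> 'a::comm_ring_1) \<Rightarrow> (nat \<Rightarrow> nat) \<Rightarrow> 'a" where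
  "coeff_det L t \<kappa> = (\<Sum>\<sigma> | \<sigma> permutes {..<L}. of_int (sign \<sigma>) *
     (\<Prod>k<L. elem_sym (2 * (L - k)) (int (2 * (L - k)) - int (\<kappa> (\<sigma> k))) (\<lambda>i. - t i)))"

lemma elem_sym_neg: "p < 0 \<Longrightarrow> elem_sym r p a = 0"
  by (simp add: elem_sym_def)

lemma decreasing_seqsD:
  assumes "\<kappa> \<in> decreasing_seqs l M"
  shows "i < l \<Longrightarrow> \<kappa> i \<le> M" "i < j \<Longrightarrow> j < l \<Longrightarrow> \<kappa> j < \<kappa> i" "l \<le> i \<Longrightarrow> \<kappa> i = 0"
  using assms unfolding decreasing_seqs_def by blast+

text \<open>
  In row $i \ge k$ the entries in columns up to $k$ vanish, because $\kappa_j \ge \kappa_k > 2(L-i)$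
  there. Rows from $k$ on and columns up to $k$ number $L+1$ in total, so every term of the
  Leibniz formula meets this zero block.
\<close>

lemma coeff_det_eq_0:
  assumes \<kappa>: "\<kappa> \<in> decreasing_seqs L M" and k: "k < L" "2 * (L - k) < \<kappa> k"
  shows "coeff_det L t \<kappa> = 0"
  unfolding coeff_det_def
proof (rule sum.neutral, rule ballI)
  fix \<sigma> assume "\<sigma> \<in> {\<sigma>. \<sigma> permutes {..<L}}"
  then have \<sigma>: "\<sigma> permutes {..<L}" by simp
  have "\<exists>i\<in>{k..<L}. \<sigma> i \<le> k"
  proof (rule ccontr)
    assume "\<not> ?thesis"
    then have "\<sigma> ` {k..<L} \<subseteq> {k<..<L}"
      using permutes_in_image[OF \<sigma>] by (auto simp: not_le)
    then have "card (\<sigma> ` {k..<L}) \<le> card {k<..<L}" by (intro card_mono) auto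
    moreover have "card (\<sigma> ` {k..<L}) = card {k..<L}"
      using permutes_inj_on[OF \<sigma>] by (rule card_image)
    ultimately show False using k by simp
  qed
  then obtain i where i: "k \<le> i" "i < L" "\<sigma> i \<le> k" by auto
  have "\<kappa> k \<le> \<kappa> (\<sigma> i)"
    using decreasing_seqsD(2)[OF \<kappa>, of "\<sigma> i" k] i k by (cases "\<sigma> i = k") simp_all
  with i k have "int (2 * (L - i)) - int (\<kappa> (\<sigma> i)) < 0" by linarith
  then have "elem_sym (2 * (L - i)) (int (2 * (L - i)) - int (\<kappa> (\<sigma> i))) (\<lambda>i. - t i) = 0"
    by (rule elem_sym_neg)
  with i(2) have "(\<Prod>k<L. elem_sym (2 * (L - k))
      (int (2 * (L - k)) - int (\<kappa> (\<sigma> k))) (\<lambda>i. - t i)) = 0"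
    by (intro prod_zero bexI[of _ i]) (simp_all only: finite_lessThan lessThan_iff)
  then show "of_int (sign \<sigma>) * (\<Prod>k<L. elem_sym (2 * (L - k))
      (int (2 * (L - k)) - int (\<kappa> (\<sigma> k))) (\<lambda>i. - t i)) = 0"
    by (simp only: mult_zero_right)
qed

lemma num_parts_double_\<delta>: "num_parts (\<lambda>i. 2 * \<delta> L i) = L"
proof -
  have "{i. 2 * \<delta> L i \<noteq> 0} = {..<L}" by (auto simp: \<delta>_def)
  then show ?thesis by (simp add: num_parts_def)
qed

lemma double_P_fin_expansion:
  fixes t :: "nat \<Rightarrow> 'a::{idom,ring_char_0}"
  assumes "L \<le> N"
  shows "double_P_fin (\<lambda>i. 2 * \<delta> L i) t N = (\<Sum>\<kappa>\<in>decreasing_seqs L (2 * L).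
    scalar (coeff_det L t \<kappa>) * P_sum xvar (map (\<lambda>k i. xvar i ^ \<kappa> k) [0..<L]) {..<N})"
proof -
  let ?F = "\<lambda>a. P_sum xvar (map (\<lambda>k i. xvar i ^ a k) [0..<L]) {..<N} :: 'a mpoly fract"
  let ?e = "\<lambda>k a. elem_sym (2 * (L - k)) (int (2 * (L - k)) - int a) (\<lambda>i. - t i)"
  have "double_P_fin (\<lambda>i. 2 * \<delta> L i) t N = P_sum xvar
      (map (\<lambda>k i. shifted_power t (xvar i) (2 * (L - k))) [0..<L]) {..<N}"
    using double_P_fin_eq_P_sum[of "\<lambda>i. 2 * \<delta> L i" N t] assms
    by (simp add: num_parts_double_\<delta>) (simp add: \<delta>_def)
  also have "\<dots> = P_sum xvar (map (\<lambda>k i. \<Sum>a\<le>2 * L. scalar (?e k a) * xvar i ^ a) [0..<L]) {..<N}"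
    by (subst shifted_power_expansion[of _ "2 * L"]) auto
  also have "\<dots> = (\<Sum>a\<in>{..<L} \<rightarrow>\<^sub>E {..2 * L}. (\<Prod>k<L. scalar (?e k (a k))) * ?F a)"
    using assms of_nat_fract_eq_0_iff[of "fact (N - L)", where 'a='a]
    by (subst P_sum_multilinear) auto
  also have "\<dots> = (\<Sum>\<kappa>\<in>decreasing_seqs L (2 * L). (\<Sum>\<sigma> | \<sigma> permutes {..<L}.
      of_int (sign \<sigma>) * (\<Prod>k<L. scalar (?e k (\<kappa> (\<sigma> k))))) * ?F \<kappa>)"
    by (rule sum_alternating) (rule P_sum_xvar_alternating; assumption)+
  also have "\<dots> = (\<Sum>\<kappa>\<in>decreasing_seqs L (2 * L). scalar (coeff_det L t \<kappa>) * ?F \<kappa>)"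
  proof -
    have "of_int (sign \<sigma>) = scalar (of_int (sign \<sigma>) :: 'a)" for \<sigma> :: "nat \<Rightarrow> nat"
      by (cases \<sigma> rule: sign_cases) (simp_all add: Const_uminus)
    then show ?thesis
      by (simp add: coeff_det_def scalar_sum scalar_prod Const_mult)
  qed
  finally show ?thesis .
qed

section \<open>The two parities in a common form\<close>

text \<open>
  With $L = n-1$, \<open>shape L b\<close> is $\delta^*_n$ for $b = 0$ and $\delta_{n-1}$ for $b = 1$. It is the
  largest $\nu$ for which the exponents $\kappa = \delta_{L-1+b}+\nu$ satisfy $\kappa_i \le 2(L-i)$, where
  $b$ is the smallest exponent allowed in the last slot.
\<close>

definition shape :: "nat \<Rightarrow> nat \<Rightarrow> nat \<Rightarrow> nat" where
  "shape L b i = (if i < L then L + 1 - b - i else 0)"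

lemma partitions_inD:
  assumes "\<nu> \<in> partitions_in \<mu>"
  shows "\<nu> i \<le> \<mu> i" "i \<le> j \<Longrightarrow> \<nu> j \<le> \<nu> i" "is_partition \<nu>"
  using assms by (simp_all add: partitions_in_def le_fun_def is_partition_def antimonoD)

lemma S_skew_eq_coeff_det:
  assumes "b \<le> 1"
  shows "S_skew (Suc L) (shape L b) \<nu> t = coeff_det L t (\<lambda>i. \<delta> (L - 1 + b) i + \<nu> i)"
proof -
  have entry: "int (shape L b i) - int (\<nu> j) + int j - int i
      = int (2 * (L - i)) - int (\<delta> (L - 1 + b) j + \<nu> j)" if "i < L" "j < L" for i j
    using that assms by (auto simp: shape_def \<delta>_def)
  have "(\<Prod>i = 0..<L. elem_sym (2 * (L - i)) (int (shape L b i) - int (\<nu> (\<sigma> i)) + int (\<sigma> i) - int i) (\<lambda>k. - t k))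
      = (\<Prod>i<L. elem_sym (2 * (L - i)) (int (2 * (L - i)) - int (\<delta> (L - 1 + b) (\<sigma> i) + \<nu> (\<sigma> i))) (\<lambda>k. - t k))"
    if "\<sigma> permutes {..<L}" for \<sigma>
    using permutes_in_image[OF that]
    by (intro prod.cong) (simp_all only: atLeast0LessThan lessThan_iff entry)
  moreover have "(\<Prod>i = 0..<L. mat L L (\<lambda>(i, j). f i j) $$ (i, \<sigma> i)) = (\<Prod>i = 0..<L. f i (\<sigma> i))"
    if "\<sigma> permutes {..<L}" for \<sigma> and f :: "nat \<Rightarrow> nat \<Rightarrow> 'a"
    using permutes_in_image[OF that] by (intro prod.cong) (auto simp: atLeast0LessThan)
  ultimately show ?thesis
    unfolding S_skew_def coeff_det_def
    by (subst det_def'[of _ L]) (auto simp: atLeast0LessThan intro!: sum.cong)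
qed

lemma decreasing_seqs_lower_bound:
  assumes "\<kappa> \<in> decreasing_seqs L M" "i < L"
  shows "\<kappa> (L - 1) + (L - 1 - i) \<le> \<kappa> i"
proof -
  have "i \<le> L - 1" using assms(2) by simp
  then show ?thesis
  proof (induction i rule: inc_induct)
    case (step i)
    then have "\<kappa> (Suc i) < \<kappa> i" by (intro decreasing_seqsD(2)[OF assms(1)]) simp_all
    with step show ?case by simp
  qed simp
qed

lemma exponents_strict_partition:
  assumes "\<nu> \<in> partitions_in (shape L b)" "b \<le> 1"
  shows "is_strict_partition (\<lambda>i. \<delta> (L - 1 + b) i + \<nu> i)"
proof (rule is_strict_partition_\<delta>_add)
  fix i assume "L - 1 + b < i"
  then have "L \<le> i" by simp
  then show "\<nu> i = 0" using partitions_inD(1)[OF assms(1), of i] by (simp add: shape_def)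
qed (rule partitions_inD(3)[OF assms(1)])

text \<open>
  Subtracting a staircase turns strictly decreasing sequences into partitions. The lower bound on
  the last entry is what makes all entries at least as large as those of the staircase.
\<close>

lemma decreasing_seqs_eq_\<delta>_add:
  assumes b: "b \<le> 1" "b = 1 \<Longrightarrow> 1 \<le> L"
  shows "{\<kappa> \<in> decreasing_seqs L (2 * L). (\<forall>i<L. \<kappa> i \<le> 2 * (L - i)) \<and> (L = 0 \<or> b \<le> \<kappa> (L - 1))}
    = (\<lambda>\<nu> i. \<delta> (L - 1 + b) i + \<nu> i) ` partitions_in (shape L b)" (is "?K = ?g ` _")
proof (intro equalityI subsetI)
  fix \<kappa> assume "\<kappa> \<in> ?K"
  then have \<kappa>: "\<kappa> \<in> decreasing_seqs L (2 * L)" and le: "\<And>i. i < L \<Longrightarrow> \<kappa> i \<le> 2 * (L - i)"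
    and last: "L = 0 \<or> b \<le> \<kappa> (L - 1)" by simp_all
  have zero: "\<kappa> i = 0" if "L \<le> i" for i by (rule decreasing_seqsD(3)[OF \<kappa> that])
  define \<nu> where "\<nu> i = \<kappa> i - \<delta> (L - 1 + b) i" for i
  have ge: "\<delta> (L - 1 + b) i \<le> \<kappa> i" for i
  proof (cases "i < L")
    case True
    then have "b \<le> \<kappa> (L - 1)" using last by simp
    moreover have "\<delta> (L - 1 + b) i = b + (L - 1 - i)" using True by (simp add: \<delta>_def)
    ultimately show ?thesis using decreasing_seqs_lower_bound[OF \<kappa> True] by linarith
  next
    case False
    then have "\<delta> (L - 1 + b) i = 0" using b by (cases "b = 0") (simp_all add: \<delta>_def)
    then show ?thesis by simp
  qed
  have "\<nu> (Suc i) \<le> \<nu> i" for i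
  proof (cases "Suc i < L")
    case True
    then have "\<kappa> (Suc i) < \<kappa> i" by (intro decreasing_seqsD(2)[OF \<kappa>]) simp_all
    moreover have "\<delta> (L - 1 + b) i = Suc (\<delta> (L - 1 + b) (Suc i))" using True by (simp add: \<delta>_def)
    ultimately show ?thesis unfolding \<nu>_def by linarith
  next
    case False
    then show ?thesis using zero[of "Suc i"] by (simp add: \<nu>_def)
  qed
  then have "antimono \<nu>" by (simp add: antimono_iff_le_Suc)
  moreover have "finite {i. \<nu> i \<noteq> 0}"
  proof (rule finite_subset[of _ "{..<L}"])
    have "\<nu> i = 0" if "\<not> i < L" for i using zero[of i] that by (simp add: \<nu>_def)
    then show "{i. \<nu> i \<noteq> 0} \<subseteq> {..<L}" by (metis (mono_tags) lessThan_iff mem_Collect_eq subsetI)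
  qed simp
  moreover have "\<nu> i \<le> shape L b i" for i
  proof (cases "i < L")
    case True
    with le[OF this] b(1) show ?thesis by (simp add: \<nu>_def \<delta>_def shape_def)
  next
    case False
    with zero[of i] show ?thesis by (simp add: \<nu>_def)
  qed
  ultimately have "\<nu> \<in> partitions_in (shape L b)" by (simp add: partitions_in_def is_partition_def le_fun_def)
  then have "?g \<nu> \<in> ?g ` partitions_in (shape L b)" by (rule imageI)
  moreover have "?g \<nu> = \<kappa>" by (rule ext) (simp only: \<nu>_def le_add_diff_inverse[OF ge])
  ultimately show "\<kappa> \<in> ?g ` partitions_in (shape L b)" by (simp only:)
next
  fix \<kappa> assume "\<kappa> \<in> ?g ` partitions_in (shape L b)"
  then obtain \<nu> where \<nu>: "\<nu> \<in> partitions_in (shape L b)" and \<kappa>: "\<kappa> = ?g \<nu>" by auto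
  note le = partitions_inD(1)[OF \<nu>] and anti = partitions_inD(2)[OF \<nu>]
  have last: "L = 0 \<or> b \<le> \<kappa> (L - 1)" unfolding \<kappa> \<delta>_def by simp
  have bound: "\<kappa> i \<le> 2 * (L - i)" if "i < L" for i
    using le[of i] that b unfolding \<kappa> shape_def \<delta>_def by auto
  have "\<kappa> i = 0" if "L \<le> i" for i
    using le[of i] that b unfolding \<kappa> shape_def \<delta>_def by (cases "b = 0") auto
  moreover have "\<kappa> j < \<kappa> i" if "i < j" "j < L" for i j
    using anti[of i j] that unfolding \<kappa> \<delta>_def by simp
  moreover have "\<kappa> i \<le> 2 * L" if "i < L" for i
    using bound[OF that] by simp
  ultimately have "\<kappa> \<in> decreasing_seqs L (2 * L)" unfolding decreasing_seqs_def by simp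
  with bound last show "\<kappa> \<in> ?K" by simp
qed

text \<open>
  For even $L$ the partition $\kappa$ may have one part less than there are slots. In an even
  number of variables an odd number of them then remains for the last slot, so the exponent $0$ in it
  contributes a factor $1$.
\<close>

lemma schur_P_padded:
  assumes \<nu>: "\<nu> \<in> partitions_in (shape L b)" and b: "b = (if even L then 0 else 1)" and m: "L \<le> 2 * m"
  defines "\<kappa> \<equiv> \<lambda>i. \<delta> (L - 1 + b) i + \<nu> i"
  shows "to_fract (schur_P \<kappa> m :: 'a::{idom,ring_char_0} mpoly) =
    P_sum xvar (map (\<lambda>k i. xvar i ^ \<kappa> k) [0..<L]) {..<2 * m}"
proof -
  have part: "is_partition \<kappa>"
    using exponents_strict_partition[OF \<nu>] b by (simp add: \<kappa>_def is_strict_partition_def)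
  have supp: "\<kappa> i \<noteq> 0 \<longleftrightarrow> i < num_parts \<kappa>" for i by (rule partition_support[OF part])
  have "\<kappa> L = 0"
    using partitions_inD(1)[OF \<nu>, of L] b odd_pos[of L] by (simp add: \<kappa>_def \<delta>_def shape_def)
  then have le: "num_parts \<kappa> \<le> L" using supp[of L] by simp
  show ?thesis
  proof (cases "num_parts \<kappa> = L")
    case True
    then show ?thesis using schur_P_limit(2)[OF part, of m] m by simp
  next
    case False
    then have L: "\<kappa> (L - 1) = 0" "L \<noteq> 0" using le supp[of "L - 1"] by auto
    then have "b = 0" using b by (auto simp: \<kappa>_def \<delta>_def split: if_splits)
    then have "even L" using b by (auto split: if_splits)
    have "L - 1 \<le> num_parts \<kappa>"
    proof (rule ccontr)
      assume "\<not> L - 1 \<le> num_parts \<kappa>"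
      with supp[of "L - 2"] \<open>b = 0\<close> show False by (simp add: \<kappa>_def \<delta>_def)
    qed
    then have num: "num_parts \<kappa> = L - 1" using le False by linarith
    have drop_last: "P_sum xvar (map (\<lambda>k i. (xvar i :: 'a mpoly fract) ^ \<kappa> k) [0..<Suc (L - 1)]) {..<2 * m}
        = P_sum xvar (map (\<lambda>k i. xvar i ^ \<kappa> k) [0..<L - 1]) {..<2 * m}"
      using P_sum_trailing_zero_exponent[of "L - 1" "2 * m" \<kappa>, where 'a='a] L m \<open>even L\<close> by auto
    have "num_parts \<kappa> \<le> 2 * m" using m le by simp
    from schur_P_limit(2)[OF part this, where 'a='a]
    have "to_fract (schur_P \<kappa> m :: 'a mpoly) =
        P_sum xvar (map (\<lambda>k i. xvar i ^ \<kappa> k) [0..<L - 1]) {..<2 * m}"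
      unfolding num .
    then show ?thesis using drop_last L by simp
  qed
qed

lemma restrict_vars_sum_Const:
  "restrict_vars N (\<Sum>a\<in>A. f a * Const (c a)) = (\<Sum>a\<in>A. restrict_vars N (f a) * Const (c a))"
  by (simp add: restrict_vars_def subst_sum subst_mult)

text \<open>
  For odd $L$, exponents with a zero in the last slot contribute nothing, since an even number of
  variables remains for that slot; this allows the smallest exponent to be $b = 1$.
\<close>

lemma double_P_double_\<delta>:
  fixes t :: "nat \<Rightarrow> 'a::{idom,ring_char_0}"
  assumes b: "b = (if even L then 0 else 1)"
  shows "double_P (\<lambda>i. 2 * \<delta> L i) t = (\<lambda>m. \<Sum>\<nu>\<in>partitions_in (shape L b).
    schur_P (\<lambda>i. \<delta> (L - 1 + b) i + \<nu> i) m * Const (S_skew (Suc L) (shape L b) \<nu> t))"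
proof (rule double_P_eqI)
  let ?\<kappa> = "\<lambda>\<nu> i. \<delta> (L - 1 + b) i + \<nu> i"
  have "b \<le> 1" using b by simp
  have "restrict_vars (2 * m) (schur_P (?\<kappa> \<nu>) (Suc m) :: 'a mpoly) = schur_P (?\<kappa> \<nu>) m"
    if "\<nu> \<in> partitions_in (shape L b)" for \<nu> m
  proof -
    have "is_partition (?\<kappa> \<nu>)"
      using exponents_strict_partition[OF that \<open>b \<le> 1\<close>] by (simp only: is_strict_partition_def)
    from schur_P_limit(1)[OF this, where 'a='a] show ?thesis
      unfolding even_limit_def by (simp only: mem_Collect_eq)
  qed
  then show "(\<lambda>m. \<Sum>\<nu>\<in>partitions_in (shape L b).
      schur_P (?\<kappa> \<nu>) m * Const (S_skew (Suc L) (shape L b) \<nu> t)) \<in> even_limit"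
    unfolding even_limit_def by (simp add: restrict_vars_sum_Const)
next
  let ?\<kappa> = "\<lambda>\<nu> i. \<delta> (L - 1 + b) i + \<nu> i"
  fix m assume "num_parts (\<lambda>i. 2 * \<delta> L i) \<le> 2 * m"
  then have m: "L \<le> 2 * m" by (simp add: num_parts_double_\<delta>)
  let ?F = "\<lambda>\<kappa>. P_sum xvar (map (\<lambda>k i. xvar i ^ \<kappa> k) [0..<L]) {..<2 * m} :: 'a mpoly fract"
  let ?K = "{\<kappa> \<in> decreasing_seqs L (2 * L). (\<forall>i<L. \<kappa> i \<le> 2 * (L - i)) \<and> (L = 0 \<or> b \<le> \<kappa> (L - 1))}"
  have K: "?K = ?\<kappa> ` partitions_in (shape L b)"
  proof (rule decreasing_seqs_eq_\<delta>_add)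
    show "b \<le> 1" using b by simp
    show "1 \<le> L" if "b = 1" using that b by (cases L) simp_all
  qed
  have inj: "inj_on ?\<kappa> (partitions_in (shape L b))"
    by (rule inj_onI) (simp add: fun_eq_iff)
  have "double_P_fin (\<lambda>i. 2 * \<delta> L i) t (2 * m) = (\<Sum>\<kappa>\<in>?K. scalar (coeff_det L t \<kappa>) * ?F \<kappa>)"
    unfolding double_P_fin_expansion[OF m]
  proof (intro sum.mono_neutral_right ballI)
    fix \<kappa> assume diff: "\<kappa> \<in> decreasing_seqs L (2 * L) - ?K"
    have \<kappa>: "\<kappa> \<in> decreasing_seqs L (2 * L)" and outside: "\<kappa> \<notin> ?K"
      using diff by blast+
    show "scalar (coeff_det L t \<kappa>) * ?F \<kappa> = 0"
    proof (cases "\<exists>i<L. 2 * (L - i) < \<kappa> i")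
      case True
      then obtain i where "i < L" "2 * (L - i) < \<kappa> i" by blast
      then have "coeff_det L t \<kappa> = 0" by (rule coeff_det_eq_0[OF \<kappa>])
      then show ?thesis by simp
    next
      case False
      then have "\<forall>i<L. \<kappa> i \<le> 2 * (L - i)" by (meson not_less)
      with \<kappa> outside have "\<not> (L = 0 \<or> b \<le> \<kappa> (L - 1))" by blast
      then have last: "L \<noteq> 0" "\<kappa> (L - 1) < b" by simp_all
      then have "odd L" using b by (cases "even L") simp_all
      have "\<kappa> (L - 1) = 0" using last b by (cases "even L") simp_all
      moreover have L: "Suc (L - 1) = L" using last(1) by simp
      moreover have "even (2 * m - (L - 1))" using \<open>odd L\<close> m by simp
      ultimately have "?F \<kappa> = 0"
        using P_sum_trailing_zero_exponent[of "L - 1" "2 * m" \<kappa>, where 'a='a, unfolded L] m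
        by (simp only: if_False simp_thms)
      then show ?thesis by (simp only: mult_zero_right)
    qed
  qed (rule finite_decreasing_seqs, rule Collect_restrict)
  also have "\<dots> = (\<Sum>\<nu>\<in>partitions_in (shape L b). scalar (coeff_det L t (?\<kappa> \<nu>)) * ?F (?\<kappa> \<nu>))"
    unfolding K sum.reindex[OF inj] by (simp only: comp_def)
  also have "\<dots> = (\<Sum>\<nu>\<in>partitions_in (shape L b).
      to_fract (schur_P (?\<kappa> \<nu>) m * Const (S_skew (Suc L) (shape L b) \<nu> t)))"
  proof (intro sum.cong refl)
    fix \<nu> assume "\<nu> \<in> partitions_in (shape L b)"
    have "b \<le> 1" using b by simp
    then have S: "S_skew (Suc L) (shape L b) \<nu> t = coeff_det L t (?\<kappa> \<nu>)"
      by (rule S_skew_eq_coeff_det)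
    show "scalar (coeff_det L t (?\<kappa> \<nu>)) * ?F (?\<kappa> \<nu>) =
        to_fract (schur_P (?\<kappa> \<nu>) m * Const (S_skew (Suc L) (shape L b) \<nu> t))"
      unfolding S to_fract_mult schur_P_padded[OF \<open>\<nu> \<in> _\<close> b m] by (rule mult.commute)
  qed
  finally show "Fract (\<Sum>\<nu>\<in>partitions_in (shape L b).
      schur_P (?\<kappa> \<nu>) m * Const (S_skew (Suc L) (shape L b) \<nu> t)) 1 = double_P_fin (\<lambda>i. 2 * \<delta> L i) t (2 * m)"
    by (simp only: to_fract_sum to_fract_def[symmetric])
qed

theorem corollary4p3:
  fixes n :: nat
  assumes "n \<ge> 1"
  shows "(odd n \<longrightarrow>
      double_P (\<lambda>i. 2 * \<delta> (n - 1) i) tvar =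
      (\<lambda>m. \<Sum>\<nu>\<in>partitions_in (\<delta>_star n).
         schur_P (\<lambda>i. \<delta> (n - 2) i + \<nu> i) m * Const (S_skew n (\<delta>_star n) \<nu> tvar)))
    \<and> (even n \<longrightarrow>
      double_P (\<lambda>i. 2 * \<delta> (n - 1) i) tvar =
      (\<lambda>m. \<Sum>\<nu>\<in>partitions_in (\<delta> (n - 1)).
         schur_P (\<lambda>i. \<delta> (n - 1) i + \<nu> i) m * Const (S_skew n (\<delta> (n - 1)) \<nu> tvar)))"
proof (intro conjI impI)
  obtain L where n: "n = Suc L" using assms by (cases n) auto
  {
    assume "odd n"
    moreover have "shape L 0 = \<delta>_star n" by (auto simp: fun_eq_iff shape_def \<delta>_star_def n)
    moreover have "L - 1 + 0 = n - 2" by (simp add: n)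
    ultimately show "double_P (\<lambda>i. 2 * \<delta> (n - 1) i) tvar =
      (\<lambda>m. \<Sum>\<nu>\<in>partitions_in (\<delta>_star n).
         schur_P (\<lambda>i. \<delta> (n - 2) i + \<nu> i) m * Const (S_skew n (\<delta>_star n) \<nu> tvar))"
      using double_P_double_\<delta>[of 0 L tvar] by (simp add: n)
  next
    assume "even n"
    then have "odd L" by (simp add: n)
    moreover from this have "L - 1 + 1 = n - 1" by (simp add: n odd_pos)
    moreover have "shape L 1 = \<delta> (n - 1)" by (auto simp: fun_eq_iff shape_def \<delta>_def n)
    ultimately show "double_P (\<lambda>i. 2 * \<delta> (n - 1) i) tvar =
      (\<lambda>m. \<Sum>\<nu>\<in>partitions_in (\<delta> (n - 1)).
         schur_P (\<lambda>i. \<delta> (n - 1) i + \<nu> i) m * Const (S_skew n (\<delta> (n - 1)) \<nu> tvar))"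
      using double_P_double_\<delta>[of 1 L tvar] by (simp add: n)
  }
qed

end
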